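(* Let $A\subseteq\omega$ be a recursively enumerable set which is $\text{low}_2$ (that is, $A''\equiv_T\emptyset''$). Then $A$ is AEWG: for almost every set $X\subseteq\omega$ there is a set $G\leq_T X$ such that $G$ is weakly 1-$A$-generic.
   Context: Sets $X\subseteq\omega$ are identified with elements of Cantor space $2^\omega$, and "almost every set" means all sets outside a class of measure $0$ for the uniform (fair-coin, Lebesgue) product measure on $2^\omega$. $2^{<\omega}$ is the set of finite binary strings, and $G\upharpoonright m$ is the initial segment of $G$ of length $m$. A set $W\subseteq 2^{<\omega}$ is dense if for every string $\sigma\in 2^{<\omega}$ there is a string $\tau\in W$ extending $\sigma$. Given a set $Z\subseteq\omega$, a set $G$ is weakly 1-$Z$-generic if for every dense $\Sigma^0_1(Z)$ (i.e. r.e. in $Z$) set $W\subseteq 2^{<\omega}$ there is $m$ such that $G\upharpoonright m\in W$. A set $B\subseteq\omega$ is AEWG if almost every set computes (i.e. Turing-computes) a set that is weakly 1-$B$-generic. $A''$ denotes the double Turing jump of $A$; $A$ is $\text{low}_2$ if $A''\equiv_T\emptyset''$. *)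

theory Defs
  imports "HOL-Probability.Probability" "HOL-Library.Nat_Bijection" "HOL-Library.Sublist"
begin

section \<open>Oracle computability\<close>

text \<open>
  Unary programs over the natural numbers with an oracle; arguments of higher arity are passed
  through the Cantor pairing \<^const>\<open>prod_encode\<close>.
\<close>

datatype program =
    Zero
  | Succ
  | First
  | Second
  | Oracle
  | Tuple program program
  | Comp program program
  | PrimRec program program
  | Minimize program

primrec run :: "nat set \<Rightarrow> program \<Rightarrow> nat \<Rightarrow> nat option" where
  "run Z Zero = (\<lambda>x. Some 0)"
| "run Z Succ = (\<lambda>x. Some (Suc x))"
| "run Z First = (\<lambda>x. Some (fst (prod_decode x)))"
| "run Z Second = (\<lambda>x. Some (snd (prod_decode x)))"
| "run Z Oracle = (\<lambda>x. Some (of_bool (x \<in> Z)))"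
| "run Z (Tuple p q) =
     (\<lambda>x. Option.bind (run Z p x) (\<lambda>u. Option.bind (run Z q x) (\<lambda>v. Some (prod_encode (u, v)))))"
| "run Z (Comp p q) = (\<lambda>x. Option.bind (run Z q x) (run Z p))"
| "run Z (PrimRec p q) =
     (\<lambda>x. case prod_decode x of (a, n) \<Rightarrow>
        rec_nat (run Z p a)
          (\<lambda>i r. Option.bind r (\<lambda>v. run Z q (prod_encode (a, prod_encode (i, v))))) n)"
| "run Z (Minimize p) =
     (\<lambda>x. let stops_at = (\<lambda>n. run Z p (prod_encode (x, n)) = Some 0 \<and>
                          (\<forall>m<n. \<exists>v. run Z p (prod_encode (x, m)) = Some (Suc v)))
        in if \<exists>n. stops_at n then Some (LEAST n. stops_at n) else None)"

text \<open>
  An effective numbering of all programs. It is given explicitly because the jump, unlike plain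
  reducibility, depends on the numbering being computable.
\<close>

lemma prod_decode_le: "fst (prod_decode k) \<le> k" "snd (prod_decode k) \<le> k"
  by (metis le_prod_encode_1 le_prod_encode_2 prod.collapse prod_decode_inverse)+

function program_of :: "nat \<Rightarrow> program" where
  "program_of e =
     (if e = 0 then Zero
      else if e = 1 then Succ
      else if e = 2 then First
      else if e = 3 then Second
      else if e = 4 then Oracle
      else
        (let k = (e - 5) div 4; a = fst (prod_decode k); b = snd (prod_decode k)
         in if (e - 5) mod 4 = 0 then Tuple (program_of a) (program_of b)
            else if (e - 5) mod 4 = 1 then Comp (program_of a) (program_of b)
            else if (e - 5) mod 4 = 2 then PrimRec (program_of a) (program_of b)
            else Minimize (program_of k)))"
  by pat_completeness auto
termination
proof (relation "Wellfounded.measure id", goal_cases)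
  case 1
  show ?case by simp
qed (auto intro: le_less_trans[OF prod_decode_le(1)] le_less_trans[OF prod_decode_le(2)])

declare program_of.simps [simp del]

lemma surj_program_of: "surj program_of"
proof -
  have [simp]: "Suc (4 * k) div 4 = k" "Suc (Suc (4 * k)) div 4 = k"
    "Suc (Suc (Suc (4 * k))) div 4 = k" "(4 * k + 2) div 4 = k" "(4 * k + 3) div 4 = k"
    "Suc (4 * k) mod 4 = 1" "Suc (Suc (4 * k)) mod 4 = 2" "Suc (Suc (Suc (4 * k))) mod 4 = 3"
    "(4 * k + 2) mod 4 = 2" "(4 * k + 3) mod 4 = 3" for k :: nat
    by presburger+
  have "\<exists>e. program_of e = p" for p
  proof (induction p)
    case Zero
    show ?case by (rule exI[of _ 0]) (simp add: program_of.simps)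
  next
    case Succ
    show ?case by (rule exI[of _ 1]) (simp add: program_of.simps)
  next
    case First
    show ?case by (rule exI[of _ 2]) (simp add: program_of.simps)
  next
    case Second
    show ?case by (rule exI[of _ 3]) (simp add: program_of.simps)
  next
    case Oracle
    show ?case by (rule exI[of _ 4]) (simp add: program_of.simps)
  next
    case (Tuple p q)
    then obtain a b where "program_of a = p" "program_of b = q" by blast
    then show ?case
      by (intro exI[of _ "4 * prod_encode (a, b) + 5"])
         (subst program_of.simps, simp add: Let_def)
  next
    case (Comp p q)
    then obtain a b where "program_of a = p" "program_of b = q" by blast
    then show ?case
      by (intro exI[of _ "4 * prod_encode (a, b) + 1 + 5"])
         (subst program_of.simps, simp add: Let_def)
  next
    case (PrimRec p q)
    then obtain a b where "program_of a = p" "program_of b = q" by blast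
    then show ?case
      by (intro exI[of _ "4 * prod_encode (a, b) + 2 + 5"])
         (subst program_of.simps, simp add: Let_def)
  next
    case (Minimize p)
    then obtain k where "program_of k = p" by blast
    then show ?case
      by (intro exI[of _ "4 * k + 3 + 5"])
         (subst program_of.simps, simp add: Let_def)
  qed
  then show ?thesis by (metis surjI)
qed

definition turing_le :: "nat set \<Rightarrow> nat set \<Rightarrow> bool" (infix "\<le>\<^sub>T" 50) where
  "Y \<le>\<^sub>T Z \<longleftrightarrow> (\<exists>p. \<forall>n. run Z p n = Some (of_bool (n \<in> Y)))"

definition turing_equiv :: "nat set \<Rightarrow> nat set \<Rightarrow> bool" (infix "\<equiv>\<^sub>T" 50) where
  "Y \<equiv>\<^sub>T Z \<longleftrightarrow> Y \<le>\<^sub>T Z \<and> Z \<le>\<^sub>T Y"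

definition re_in :: "nat set \<Rightarrow> nat set \<Rightarrow> bool" where
  "re_in Z Y \<longleftrightarrow> (\<exists>p. Y = {n. run Z p n \<noteq> None})"

abbreviation recursively_enumerable :: "nat set \<Rightarrow> bool" where
  "recursively_enumerable Y \<equiv> re_in {} Y"

definition jump :: "nat set \<Rightarrow> nat set" where
  "jump Z = {e. run Z (program_of e) e \<noteq> None}"

definition low2 :: "nat set \<Rightarrow> bool" where
  "low2 Z \<longleftrightarrow> jump (jump Z) \<equiv>\<^sub>T jump (jump {})"


section \<open>Weak genericity\<close>

text \<open>Strings are coded by numbers so that it makes sense for a set of strings to be r.e. in a set.\<close>

definition string_code :: "bool list \<Rightarrow> nat" where
  "string_code \<sigma> = list_encode (map of_bool \<sigma>)"

definition re_strings_in :: "nat set \<Rightarrow> bool list set \<Rightarrow> bool" where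
  "re_strings_in Z W \<longleftrightarrow> re_in Z (string_code ` W)"

definition dense_strings :: "bool list set \<Rightarrow> bool" where
  "dense_strings W \<longleftrightarrow> (\<forall>\<sigma>. \<exists>\<tau>\<in>W. prefix \<sigma> \<tau>)"

definition initial_segment :: "nat set \<Rightarrow> nat \<Rightarrow> bool list" where
  "initial_segment G m = map (\<lambda>i. i \<in> G) [0..<m]"

definition weakly_1_generic :: "nat set \<Rightarrow> nat set \<Rightarrow> bool" where
  "weakly_1_generic Z G \<longleftrightarrow>
     (\<forall>W. dense_strings W \<and> re_strings_in Z W \<longrightarrow> (\<exists>m. initial_segment G m \<in> W))"


section \<open>Almost every set\<close>

definition cantor_measure :: "(nat \<Rightarrow> bool) measure" where
  "cantor_measure = PiM UNIV (\<lambda>_. measure_pmf (bernoulli_pmf (1/2)))"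

text \<open>
  A point of Cantor space is a characteristic function, so \<^term>\<open>Collect X\<close> is the corresponding
  set of natural numbers.
\<close>

definition AEWG :: "nat set \<Rightarrow> bool" where
  "AEWG B \<longleftrightarrow> (AE X in cantor_measure. \<exists>G. G \<le>\<^sub>T Collect X \<and> weakly_1_generic B G)"

end

theory Submission
  imports Defs
begin

text \<open>
  Fix a computable enumeration of \<open>A\<close> with stages \<open>A\<^sub>t\<close>. The set \<open>G\<close> is computed from \<open>X\<close> by a
  process in stages that makes attempts to enter the dense sets; bits of \<open>X\<close> serve as coin tosses that
  decide which attempts \<open>X\<close> joins. A strategy \<open>q\<close> is a pair \<open>(e, d)\<close>: it serves the \<open>e\<close>-th set of
  strings \<open>W\<close> that is r.e. in \<open>A\<close>, and \<open>d\<close> is a guess explained below. When \<open>q\<close> has no pending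
  attempt it opens one at a stage \<open>n\<close> of its own. The sequences \<open>X\<close> that pass a coin test of probability \<open>2^-(q + c)\<close>, and are not
  busy, now stop building \<open>G\<close> and wait for the attempt. The attempt waits for a witness, a single
  string \<open>u\<close> that leads every string of length at most \<open>n\<^sup>2\<close> into \<open>W\<close>, as confirmed by a finite
  computation trace whose positive oracle answers are already enumerated and whose negative ones are
  not yet refuted. On release, \<open>u\<close> is appended to \<open>G\<close>. A strategy has at most one pending attempt,
  so \<open>X\<close> gets stuck forever with probability at most \<open>2^(1 - c)\<close>; otherwise \<open>G\<close> is total and
  computable from \<open>X\<close>.

  The danger is that infinitely many attempts are released with witnesses that \<open>A\<close> later refutes.
  This is where low2 is used. Let \<open>P e\<close> say that every strategy \<open>(e, d)\<close> holds, at arbitrarily late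
  stages, a pending attempt whose current witness is correct for \<open>A\<close>. This is a \<open>\<Pi>\<^sub>2\<close> statement over
  \<open>A\<close>, hence decided by \<open>A''\<close>, hence, \<open>A\<close> being low2, an iterated limit \<open>lim\<^sub>s lim\<^sub>t\<close> of a
  computable function \<open>r\<close> (\<open>low2_approx\<close>). A release at stage \<open>t\<close> of the attempt \<open>n\<close> additionally
  requires that \<open>r\<close>, read at \<open>t\<close>, confirms \<open>P e\<close> for all \<open>s\<close> between \<open>d\<close> and \<open>n\<close>. Since \<open>P\<close> speaks
  about the construction that consults \<open>r\<close>, a fixed point is taken (\<open>Pi2_fixed_point\<close>). If \<open>W\<close> is
  dense, then \<open>P e\<close> holds: otherwise the guard eventually blocks every late attempt of every strategy
  for \<open>e\<close>, so each of these strategies ends up with one attempt pending forever, and it then holds a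
  correct witness from some stage on. Knowing \<open>P e\<close>, the guard with a large enough \<open>d\<close> never blocks
  forever, all attempts of \<open>(e, d)\<close> are released, and infinitely many of them with a correct witness
  (\<open>infinitely_many_successes\<close>).

  It remains to see that almost every \<open>X\<close> that is not stuck takes part in one of these successful
  attempts. \<open>X\<close> takes part in the attempt \<open>n\<close> if it passes the coin test of \<open>n\<close> and fails the tests
  of all other attempts pending at \<open>n\<close> that will be released; this has probability bounded below.
  Each of those other attempts is pending at only finitely many stages, so a subsequence of
  successful attempts depends on disjoint sets of coins, and independence does the rest
  (\<open>AE_stuck_or_served\<close>). Finally \<open>c\<close> tends to infinity (\<open>AE_not_always_stuck\<close>).
\<close>

section \<open>Closure properties of oracle computability\<close>

abbreviation pr :: "nat \<Rightarrow> nat \<Rightarrow> nat" where "pr a b \<equiv> prod_encode (a, b)"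
abbreviation pfst :: "nat \<Rightarrow> nat" where "pfst x \<equiv> fst (prod_decode x)"
abbreviation psnd :: "nat \<Rightarrow> nat" where "psnd x \<equiv> snd (prod_decode x)"

definition computable_in :: "nat set \<Rightarrow> (nat \<Rightarrow> nat) \<Rightarrow> bool" where
  "computable_in Z f \<longleftrightarrow> (\<exists>p. \<forall>x. run Z p x = Some (f x))"

definition decidable_in :: "nat set \<Rightarrow> (nat \<Rightarrow> bool) \<Rightarrow> bool" where
  "decidable_in Z P \<longleftrightarrow> computable_in Z (\<lambda>x. of_bool (P x))"

text \<open>
  Computability of a concrete function is shown by \<open>intro computability\<close>, which descends through its
  defining term. Rules that bind a variable take their premise with the bound variable and the
  environment packed into one number.
\<close>

named_theorems computability

lemma pr_eta: "pr (pfst x) (psnd x) = x"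
  by simp

lemma comp_id [computability]: "computable_in Z (\<lambda>x. x)"
  unfolding computable_in_def by (rule exI[of _ "Tuple First Second"]) simp

lemma computable_in_comp:
  assumes "computable_in Z g" "computable_in Z f"
  shows "computable_in Z (\<lambda>x. g (f x))"
proof -
  obtain p q where "\<forall>x. run Z p x = Some (g x)" "\<forall>x. run Z q x = Some (f x)"
    using assms unfolding computable_in_def by blast
  then show ?thesis unfolding computable_in_def by (intro exI[of _ "Comp p q"]) simp
qed

lemma comp_Suc [computability]: "computable_in Z f \<Longrightarrow> computable_in Z (\<lambda>x. Suc (f x))"
  by (rule computable_in_comp[of Z Suc]) (auto simp: computable_in_def intro!: exI[of _ Succ])

lemma comp_pfst [computability]: "computable_in Z f \<Longrightarrow> computable_in Z (\<lambda>x. pfst (f x))"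
  by (rule computable_in_comp[of Z pfst]) (auto simp: computable_in_def intro!: exI[of _ First])

lemma comp_psnd [computability]: "computable_in Z f \<Longrightarrow> computable_in Z (\<lambda>x. psnd (f x))"
  by (rule computable_in_comp[of Z psnd]) (auto simp: computable_in_def intro!: exI[of _ Second])

lemma comp_zero: "computable_in Z (\<lambda>x. 0)"
  unfolding computable_in_def by (rule exI[of _ Zero]) simp

lemma comp_const [computability]: "computable_in Z (\<lambda>x. k)"
  by (induction k) (auto intro: comp_zero comp_Suc)

lemma comp_pr [computability]:
  assumes "computable_in Z f" "computable_in Z g"
  shows "computable_in Z (\<lambda>x. pr (f x) (g x))"
proof -
  obtain p q where "\<forall>x. run Z p x = Some (f x)" "\<forall>x. run Z q x = Some (g x)"
    using assms unfolding computable_in_def by blast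
  then show ?thesis unfolding computable_in_def by (intro exI[of _ "Tuple p q"]) simp
qed

lemma comp_rec_nat [computability]:
  assumes "computable_in Z b"
    and "computable_in Z (\<lambda>y. s (pfst y) (pfst (psnd y)) (psnd (psnd y)))"
    and "computable_in Z n"
  shows "computable_in Z (\<lambda>x. rec_nat (b x) (s x) (n x))"
proof -
  obtain p q where pq: "\<And>x. run Z p x = Some (b x)"
    "\<And>y. run Z q y = Some (s (pfst y) (pfst (psnd y)) (psnd (psnd y)))"
    using assms unfolding computable_in_def by blast
  have "rec_nat (run Z p a) (\<lambda>i r. Option.bind r (\<lambda>v. run Z q (pr a (pr i v)))) k
      = Some (rec_nat (b a) (s a) k)" for a k
    by (induction k) (auto simp: pq)
  then have "computable_in Z (\<lambda>y. rec_nat (b (pfst y)) (s (pfst y)) (psnd y))"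
    unfolding computable_in_def by (intro exI[of _ "PrimRec p q"]) (simp add: case_prod_beta)
  from computable_in_comp[OF this comp_pr[OF comp_id assms(3)]] show ?thesis by simp
qed

lemma computable_in_comp2:
  assumes "computable_in Z (\<lambda>y. h (pfst y) (psnd y))" "computable_in Z f" "computable_in Z g"
  shows "computable_in Z (\<lambda>x. h (f x) (g x))"
  using computable_in_comp[OF assms(1) comp_pr[OF assms(2,3)]] by simp

lemma decidable_in_comp:
  "decidable_in Z P \<Longrightarrow> computable_in Z f \<Longrightarrow> decidable_in Z (\<lambda>x. P (f x))"
  unfolding decidable_in_def by (rule computable_in_comp)

lemma decidable_in_comp2:
  assumes "decidable_in Z (\<lambda>y. h (pfst y) (psnd y))" "computable_in Z f" "computable_in Z g"
  shows "decidable_in Z (\<lambda>x. h (f x) (g x))"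
  using decidable_in_comp[OF assms(1) comp_pr[OF assms(2,3)]] by simp

lemma decidable_in_comp3:
  assumes "decidable_in Z (\<lambda>y. h (pfst y) (pfst (psnd y)) (psnd (psnd y)))"
    "computable_in Z f" "computable_in Z g" "computable_in Z k"
  shows "decidable_in Z (\<lambda>x. h (f x) (g x) (k x))"
  using decidable_in_comp[OF assms(1) comp_pr[OF assms(2) comp_pr[OF assms(3,4)]]] by simp

lemma comp_add [computability]:
  assumes "computable_in Z f" "computable_in Z g"
  shows "computable_in Z (\<lambda>x. f x + g x)"
proof -
  have "rec_nat a (\<lambda>_. Suc) n = a + n" for a n by (induction n) auto
  moreover have "computable_in Z (\<lambda>x. rec_nat (f x) (\<lambda>_. Suc) (g x))"
    by (intro computability assms)
  ultimately show ?thesis by simp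
qed

lemma comp_mult [computability]:
  assumes "computable_in Z f" "computable_in Z g"
  shows "computable_in Z (\<lambda>x. f x * g x)"
proof -
  have "rec_nat 0 (\<lambda>_ v. v + a) n = a * n" for a n :: nat by (induction n) auto
  moreover have "computable_in Z (\<lambda>x. rec_nat 0 (\<lambda>_ v. v + f x) (g x))"
    by (intro computability assms computable_in_comp[OF assms(1)])
  ultimately show ?thesis by simp
qed

lemma comp_power [computability]:
  assumes "computable_in Z f" "computable_in Z g"
  shows "computable_in Z (\<lambda>x. f x ^ g x)"
proof -
  have "rec_nat 1 (\<lambda>_ v. v * a) n = a ^ n" for a n :: nat by (induction n) auto
  moreover have "computable_in Z (\<lambda>x. rec_nat 1 (\<lambda>_ v. v * f x) (g x))"
    by (intro computability assms computable_in_comp[OF assms(1)])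
  ultimately show ?thesis by simp
qed

lemma comp_diff [computability]:
  assumes "computable_in Z f" "computable_in Z g"
  shows "computable_in Z (\<lambda>x. f x - g x)"
proof -
  have pred: "rec_nat 0 (\<lambda>i _. i) n = n - 1" for n :: nat by (cases n) auto
  have "computable_in Z (\<lambda>x. rec_nat 0 (\<lambda>i _. i) (h x))" if "computable_in Z h" for h
    by (intro computability that)
  then have *: "computable_in Z (\<lambda>x. h x - 1)" if "computable_in Z h" for h
    using that by (simp only: pred)
  have "rec_nat a (\<lambda>_ v. v - 1) n = a - n" for a n :: nat by (induction n) auto
  moreover have "computable_in Z (\<lambda>x. rec_nat (f x) (\<lambda>_ v. v - 1) (g x))"
    by (intro comp_rec_nat assms * computability)
  ultimately show ?thesis by simp
qed

lemma dec_le [computability]: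
  assumes "computable_in Z f" "computable_in Z g"
  shows "decidable_in Z (\<lambda>x. f x \<le> g x)"
proof -
  have "computable_in Z (\<lambda>x. 1 - (f x - g x))" by (intro computability assms)
  moreover have "(1 - (f x - g x)) = of_bool (f x \<le> g x)" for x by simp
  ultimately show ?thesis unfolding decidable_in_def by simp
qed

lemma dec_less [computability]:
  assumes "computable_in Z f" "computable_in Z g"
  shows "decidable_in Z (\<lambda>x. f x < g x)"
  using dec_le[OF comp_Suc[OF assms(1)] assms(2)] by (simp add: Suc_le_eq)

lemma comp_of_bool [computability]:
  "decidable_in Z P \<Longrightarrow> computable_in Z (\<lambda>x. of_bool (P x))"
  unfolding decidable_in_def .

lemma dec_not [computability]:
  assumes "decidable_in Z P"
  shows "decidable_in Z (\<lambda>x. \<not> P x)"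
proof -
  have "computable_in Z (\<lambda>x. 1 - of_bool (P x))" by (intro computability assms)
  moreover have "(1 - of_bool (P x) :: nat) = of_bool (\<not> P x)" for x by simp
  ultimately show ?thesis unfolding decidable_in_def by simp
qed

lemma dec_conj [computability]:
  assumes "decidable_in Z P" "decidable_in Z Q"
  shows "decidable_in Z (\<lambda>x. P x \<and> Q x)"
proof -
  have "computable_in Z (\<lambda>x. of_bool (P x) * of_bool (Q x))" by (intro computability assms)
  moreover have "(of_bool (P x) * of_bool (Q x) :: nat) = of_bool (P x \<and> Q x)" for x by simp
  ultimately show ?thesis unfolding decidable_in_def by simp
qed

lemma dec_disj [computability]:
  assumes "decidable_in Z P" "decidable_in Z Q"
  shows "decidable_in Z (\<lambda>x. P x \<or> Q x)"
  using dec_not[OF dec_conj[OF dec_not[OF assms(1)] dec_not[OF assms(2)]]] by simp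

lemma dec_imp [computability]:
  assumes "decidable_in Z P" "decidable_in Z Q"
  shows "decidable_in Z (\<lambda>x. P x \<longrightarrow> Q x)"
  using dec_disj[OF dec_not[OF assms(1)] assms(2)] by (simp only: imp_conv_disj)

lemma dec_eq [computability]:
  assumes "computable_in Z f" "computable_in Z g"
  shows "decidable_in Z (\<lambda>x. f x = g x)"
  using dec_conj[OF dec_le[OF assms] dec_le[OF assms(2,1)]] by (simp only: order_eq_iff)

lemma comp_if [computability]:
  assumes "decidable_in Z P" "computable_in Z f" "computable_in Z g"
  shows "computable_in Z (\<lambda>x. if P x then f x else g x)"
proof -
  have "computable_in Z (\<lambda>x. of_bool (P x) * f x + of_bool (\<not> P x) * g x)" by (intro computability assms)
  moreover have "of_bool (P x) * f x + of_bool (\<not> P x) * g x = (if P x then f x else g x)" for x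
    by simp
  ultimately show ?thesis by simp
qed

lemma dec_if [computability]:
  assumes "decidable_in Z P" "decidable_in Z Q" "decidable_in Z R"
  shows "decidable_in Z (\<lambda>x. if P x then Q x else R x)"
proof -
  have "decidable_in Z (\<lambda>x. (P x \<longrightarrow> Q x) \<and> (\<not> P x \<longrightarrow> R x))" by (intro computability assms)
  then show ?thesis by (simp only: if_bool_eq_conj)
qed

lemma dec_oracle:
  assumes "computable_in Z f" shows "decidable_in Z (\<lambda>x. f x \<in> Z)"
proof -
  have "decidable_in Z (\<lambda>x. x \<in> Z)"
    unfolding decidable_in_def computable_in_def by (rule exI[of _ Oracle]) simp
  then show ?thesis using assms by (rule decidable_in_comp)
qed

lemma Minimize_eq:
  assumes "\<And>y. run Z p y = Some (f y)"
  shows "run Z (Minimize p) x =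
    (if \<exists>n. f (pr x n) = 0 then Some (LEAST n. f (pr x n) = 0) else None)"
proof -
  have *: "(run Z p (pr x n) = Some 0 \<and> (\<forall>m<n. \<exists>v. run Z p (pr x m) = Some (Suc v)))
      \<longleftrightarrow> f (pr x n) = 0 \<and> (\<forall>m<n. f (pr x m) \<noteq> 0)" for n
    by (auto simp: assms not0_implies_Suc)
  show ?thesis
  proof (cases "\<exists>n. f (pr x n) = 0")
    case True
    define l where "l = (LEAST n. f (pr x n) = 0)"
    have l: "f (pr x l) = 0" unfolding l_def using True by (rule LeastI_ex)
    have less: "f (pr x m) \<noteq> 0" if "m < l" for m
      using that unfolding l_def by (rule not_less_Least)
    have "(LEAST n. f (pr x n) = 0 \<and> (\<forall>m<n. f (pr x m) \<noteq> 0)) = l"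
      by (rule Least_equality) (use l less in \<open>blast intro: leI\<close>)+
    then show ?thesis
      using True l less unfolding run.simps Let_def * l_def[symmetric] by auto
  next
    case False
    then show ?thesis unfolding run.simps Let_def * by auto
  qed
qed

lemma comp_Least:
  assumes "decidable_in Z (\<lambda>y. P (pfst y) (psnd y))" "\<And>x. \<exists>n. P x n"
  shows "computable_in Z (\<lambda>x. LEAST n. P x n)"
proof -
  obtain p where p: "\<And>y. run Z p y = Some (of_bool (\<not> P (pfst y) (psnd y)))"
    using dec_not[OF assms(1)] unfolding decidable_in_def computable_in_def by blast
  have "run Z (Minimize p) x = Some (LEAST n. P x n)" for x
    using assms(2)[of x] unfolding Minimize_eq[OF p] by simp
  then show ?thesis unfolding computable_in_def by (intro exI[of _ "Minimize p"] allI)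
qed

text \<open>
  A bounded search is an unbounded one that also stops at the bound; the predicate is then
  tested at the place where the search stopped.
\<close>

lemma dec_bex_le [computability]:
  assumes "decidable_in Z (\<lambda>y. P (pfst y) (psnd y))" "computable_in Z b"
  shows "decidable_in Z (\<lambda>x. \<exists>i\<le>b x. P x i)"
proof -
  have "decidable_in Z (\<lambda>x. P x (LEAST i. P x i \<or> b x \<le> i))"
  proof (rule decidable_in_comp2[OF assms(1) comp_id], rule comp_Least)
    show "decidable_in Z (\<lambda>y. P (pfst y) (psnd y) \<or> b (pfst y) \<le> psnd y)"
      by (intro computability assms(1) computable_in_comp[OF assms(2)])
  qed auto
  moreover have "P x (LEAST i. P x i \<or> b x \<le> i) \<longleftrightarrow> (\<exists>i\<le>b x. P x i)"
    (is "P x ?l \<longleftrightarrow> _") for x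
  proof
    have "?l \<le> b x" by (rule Least_le[of "\<lambda>i. P x i \<or> b x \<le> i"]) simp
    then show "P x ?l \<Longrightarrow> \<exists>i\<le>b x. P x i" by auto
  next
    assume "\<exists>i\<le>b x. P x i"
    then obtain i where i: "i \<le> b x" "P x i" by auto
    then have "?l \<le> i" by (intro Least_le[of "\<lambda>i. P x i \<or> b x \<le> i"]) simp
    moreover have "P x ?l \<or> b x \<le> ?l" by (rule LeastI[of "\<lambda>i. P x i \<or> b x \<le> i" i]) (use i in simp)
    ultimately show "P x ?l" using i by (metis (no_types) order.antisym order.trans)
  qed
  ultimately show ?thesis by simp
qed

lemma dec_ball_le [computability]:
  assumes "decidable_in Z (\<lambda>y. P (pfst y) (psnd y))" "computable_in Z b"
  shows "decidable_in Z (\<lambda>x. \<forall>i\<le>b x. P x i)"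
  using dec_not[OF dec_bex_le[OF dec_not[OF assms(1)] assms(2)]] by simp

lemma dec_ball_less [computability]:
  assumes "decidable_in Z (\<lambda>y. P (pfst y) (psnd y))" "computable_in Z b"
  shows "decidable_in Z (\<lambda>x. \<forall>i<b x. P x i)"
proof -
  have "decidable_in Z (\<lambda>x. \<forall>i\<le>b x. i < b x \<longrightarrow> P x i)"
    by (intro computability assms computable_in_comp[OF assms(2)])
  moreover have "(\<forall>i\<le>b x. i < b x \<longrightarrow> P x i) \<longleftrightarrow> (\<forall>i<b x. P x i)" for x by auto
  ultimately show ?thesis by simp
qed

lemma comp_div [computability]:
  assumes "computable_in Z f" "computable_in Z g"
  shows "computable_in Z (\<lambda>x. f x div g x)"
proof -
  have "(LEAST k. a < b * Suc k \<or> b = 0) = a div b" for a b :: nat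
  proof (cases "b = 0")
    case True then show ?thesis by (simp add: Least_eq_0)
  next
    case False
    show ?thesis
    proof (rule Least_equality)
      show "a < b * Suc (a div b) \<or> b = 0" using False dividend_less_times_div[of b a] by simp
    next
      fix k assume "a < b * Suc k \<or> b = 0"
      then have "a div b < Suc k" using False by (simp add: less_mult_imp_div_less mult.commute)
      then show "a div b \<le> k" by simp
    qed
  qed
  moreover have "computable_in Z (\<lambda>x. LEAST k. f x < g x * Suc k \<or> g x = 0)"
  proof (rule comp_Least)
    show "decidable_in Z (\<lambda>y. f (pfst y) < g (pfst y) * Suc (psnd y) \<or> g (pfst y) = 0)"
      by (intro computability computable_in_comp[OF assms(1)] computable_in_comp[OF assms(2)])
    show "\<exists>k. f x < g x * Suc k \<or> g x = 0" for x
      by (metis dividend_less_times_div mult_Suc_right neq0_conv)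
  qed
  ultimately show ?thesis by simp
qed

lemma comp_mod [computability]:
  assumes "computable_in Z f" "computable_in Z g"
  shows "computable_in Z (\<lambda>x. f x mod g x)"
proof -
  have "computable_in Z (\<lambda>x. f x - g x * (f x div g x))" by (intro computability assms)
  then show ?thesis by (simp add: minus_mult_div_eq_mod)
qed

lemma dec_bit [computability]:
  assumes "computable_in Z f" "computable_in Z g"
  shows "decidable_in Z (\<lambda>x. bit (f x) (g x))"
proof -
  have "decidable_in Z (\<lambda>x. f x div 2 ^ g x mod 2 = 1)" by (intro computability assms)
  then show ?thesis by (simp only: bit_iff_odd odd_iff_mod_2_eq_one)
qed

text \<open>
  The empty oracle answers 0 to every query, so replacing \<^const>\<open>Oracle\<close> by \<^const>\<open>Zero\<close>
  removes the dependence on the oracle.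
\<close>

lemma computable_in_mono:
  assumes "computable_in {} f" shows "computable_in Z f"
proof -
  have "\<exists>q. run Z q = run {} p" for p
  proof (induction p)
    case Oracle
    show ?case by (rule exI[of _ Zero]) (auto simp: fun_eq_iff)
  next
    case (Tuple p1 p2)
    then obtain a b where "run Z a = run {} p1" "run Z b = run {} p2" by blast
    then show ?case by (intro exI[of _ "Tuple a b"]) simp
  next
    case (Comp p1 p2)
    then obtain a b where "run Z a = run {} p1" "run Z b = run {} p2" by blast
    then show ?case by (intro exI[of _ "Comp a b"]) simp
  next
    case (PrimRec p1 p2)
    then obtain a b where "run Z a = run {} p1" "run Z b = run {} p2" by blast
    then show ?case by (intro exI[of _ "PrimRec a b"]) simp
  next
    case (Minimize p)
    then obtain a where "run Z a = run {} p" by blast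
    then show ?case by (intro exI[of _ "Minimize a"]) simp
  next
    case Zero show ?case by (rule exI[of _ Zero]) simp
  next
    case Succ show ?case by (rule exI[of _ Succ]) simp
  next
    case First show ?case by (rule exI[of _ First]) simp
  next
    case Second show ?case by (rule exI[of _ Second]) simp
  qed
  then show ?thesis using assms unfolding computable_in_def by metis
qed

lemma decidable_in_mono: "decidable_in {} P \<Longrightarrow> decidable_in Z P"
  unfolding decidable_in_def by (rule computable_in_mono)

section \<open>Finite traces of computations\<close>

text \<open>
  The code of the claim that program \<open>e\<close> on input \<open>x\<close> returns \<open>y\<close>.
\<close>

abbreviation triple :: "nat \<Rightarrow> nat \<Rightarrow> nat \<Rightarrow> nat" where
  "triple e x y \<equiv> pr e (pr x y)"

text \<open>
  The clauses of \<^const>\<open>run\<close>, read on program indices: the claim follows in one step from claims in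
  \<open>S\<close>. Oracle claims are only asked to be bits, because whether they are right is
  a separate condition, \<open>queries_ok\<close> below.
\<close>

definition justified :: "nat set \<Rightarrow> nat \<Rightarrow> nat \<Rightarrow> nat \<Rightarrow> bool" where
  "justified S e x y \<longleftrightarrow>
     (let k = (e - 5) div 4; r = (e - 5) mod 4; a = pfst k; b = psnd k in
     if e = 0 then y = 0
     else if e = 1 then y = Suc x
     else if e = 2 then y = pfst x
     else if e = 3 then y = psnd x
     else if e = 4 then y \<le> 1
     else if r = 0 then triple a x (pfst y) \<in> S \<and> triple b x (psnd y) \<in> S
     else if r = 1 then \<exists>u. triple b x u \<in> S \<and> triple a u y \<in> S
     else if r = 2 then
       (if psnd x = 0 then triple a (pfst x) y \<in> S
        else \<exists>v. triple e (pr (pfst x) (psnd x - 1)) v \<in> S \<and>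
                 triple b (pr (pfst x) (pr (psnd x - 1) v)) y \<in> S)
     else triple k (pr x y) 0 \<in> S \<and> (\<forall>m<y. \<exists>v. triple k (pr x m) (Suc v) \<in> S))"

text \<open>
  A finite set of claims closed under justification serves as a halting computation. No order on the
  claims is recorded: justification always refers to a smaller index, or to the same index
  and a smaller input, so circular support cannot occur.
\<close>

definition closed_trace :: "nat set \<Rightarrow> bool" where
  "closed_trace S \<longleftrightarrow> (\<forall>e x y. triple e x y \<in> S \<longrightarrow> justified S e x y)"

text \<open>
  Positive and negative answers are judged by two different sets. At a stage of an enumeration the
  positive answers can be checked against an early approximation, while the negative ones stay
  exposed to later elements; keeping \<open>P\<close> fixed and letting \<open>N\<close> grow makes the condition decrease.
\<close>

definition queries_ok :: "nat set \<Rightarrow> nat set \<Rightarrow> nat set \<Rightarrow> bool" where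
  "queries_ok P N S \<longleftrightarrow> (\<forall>x. (triple 4 x 0 \<in> S \<longrightarrow> x \<notin> N) \<and> (triple 4 x 1 \<in> S \<longrightarrow> x \<in> P))"

lemma justified_mono: "justified S e x y \<Longrightarrow> S \<subseteq> T \<Longrightarrow> justified T e x y"
  unfolding justified_def Let_def by (auto split: if_splits simp: subset_eq) metis+

lemma closed_trace_Union: "(\<And>S. S \<in> F \<Longrightarrow> closed_trace S) \<Longrightarrow> closed_trace (\<Union>F)"
  unfolding closed_trace_def by (meson Union_iff Union_upper justified_mono)

lemma closed_trace_UN: "(\<And>i. i \<in> I \<Longrightarrow> closed_trace (S i)) \<Longrightarrow> closed_trace (\<Union>i\<in>I. S i)"
  by (rule closed_trace_Union) auto

lemma closed_trace_Un: "closed_trace S \<Longrightarrow> closed_trace T \<Longrightarrow> closed_trace (S \<union> T)"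
  using closed_trace_Union[of "{S, T}"] by auto

lemma closed_trace_insert:
  "closed_trace S \<Longrightarrow> justified (insert (triple e x y) S) e x y \<Longrightarrow> closed_trace (insert (triple e x y) S)"
  unfolding closed_trace_def by (auto intro: justified_mono)

lemma queries_ok_UN: "(\<And>i. i \<in> I \<Longrightarrow> queries_ok P N (S i)) \<Longrightarrow> queries_ok P N (\<Union>i\<in>I. S i)"
  unfolding queries_ok_def by blast
lemma queries_ok_Un: "queries_ok P N S \<Longrightarrow> queries_ok P N T \<Longrightarrow> queries_ok P N (S \<union> T)"
  unfolding queries_ok_def by auto
lemma queries_ok_insert: "queries_ok P N S \<Longrightarrow> e \<noteq> 4 \<Longrightarrow> queries_ok P N (insert (triple e x y) S)"
  unfolding queries_ok_def by auto

lemma pr_strict_mono_right: "a < b \<Longrightarrow> pr c a < pr c b"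
proof -
  have "strict_mono triangle"
    by (rule strict_monoI_Suc) simp
  then show "a < b \<Longrightarrow> pr c a < pr c b"
    by (auto simp: prod_encode_def strict_mono_def intro: add_less_le_mono)
qed

lemma program_of_base:
  "program_of 0 = Zero" "program_of (Suc 0) = Succ" "program_of 2 = First" "program_of 3 = Second" "program_of 4 = Oracle"
  by (simp_all add: program_of.simps)

lemma program_of_step:
  assumes "5 \<le> e"
  shows "program_of e =
        (let k = (e - 5) div 4; a = fst (prod_decode k); b = snd (prod_decode k)
         in if (e - 5) mod 4 = 0 then Tuple (program_of a) (program_of b)
            else if (e - 5) mod 4 = 1 then Comp (program_of a) (program_of b)
            else if (e - 5) mod 4 = 2 then PrimRec (program_of a) (program_of b)
            else Minimize (program_of k))"
  using assms by (subst program_of.simps) auto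

lemma sub_index_less:
  assumes "5 \<le> e"
  shows "(e - 5) div 4 < e" "pfst ((e - 5) div 4) < e" "psnd ((e - 5) div 4) < e"
proof -
  show *: "(e - 5) div 4 < e" using assms by auto
  show "pfst ((e - 5) div 4) < e" "psnd ((e - 5) div 4) < e"
    using prod_decode_le[of "(e - 5) div 4"] * by linarith+
qed

lemma run_PrimRec_Suc:
  "run Z (PrimRec p q) (pr a (Suc n)) =
     Option.bind (run Z (PrimRec p q) (pr a n)) (\<lambda>v. run Z q (pr a (pr n v)))"
  by simp

lemma run_PrimRec_0: "run Z (PrimRec p q) (pr a 0) = run Z p a"
  by simp

text \<open>
  Induction on the index and then the input, in the order in which justification descends.
\<close>

lemma trace_sound:
  assumes "closed_trace S" "queries_ok Z Z S" "triple e x y \<in> S"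
  shows "run Z (program_of e) x = Some y"
  using assms(3)
proof (induction "(e, x)" arbitrary: e x y rule: wf_induct[OF wf_lex_prod[OF wf_less_than wf_less_than]])
  case 1
  have IH: "run Z (program_of e') x' = Some y'"
    if "triple e' x' y' \<in> S" "e' < e \<or> e' = e \<and> x' < x" for e' x' y'
    using 1(1)[rule_format, of "(e', x')" e' x' y'] that by auto
  have J: "justified S e x y" using assms(1) 1(2) unfolding closed_trace_def by blast
  define k where "k = (e - 5) div 4"
  define r where "r = (e - 5) mod 4"
  consider "e = 0" | "e = 1" | "e = 2" | "e = 3" | "e = 4" | "5 \<le> e" by linarith
  then show ?case
  proof cases
    case 5
    then have "y \<le> 1" using J unfolding justified_def by simp
    then have "y = 0 \<or> y = 1" by auto
    then have "y = of_bool (x \<in> Z)" using assms(2) 1(2) 5 unfolding queries_ok_def by auto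
    then show ?thesis using 5 by (simp add: program_of_base)
  next
    case 6
    note less = sub_index_less[OF 6, folded k_def]
    have J': "if r = 0 then triple (pfst k) x (pfst y) \<in> S \<and> triple (psnd k) x (psnd y) \<in> S
     else if r = 1 then \<exists>u. triple (psnd k) x u \<in> S \<and> triple (pfst k) u y \<in> S
     else if r = 2 then
       (if psnd x = 0 then triple (pfst k) (pfst x) y \<in> S
        else \<exists>v. triple e (pr (pfst x) (psnd x - 1)) v \<in> S \<and>
                 triple (psnd k) (pr (pfst x) (pr (psnd x - 1) v)) y \<in> S)
     else triple k (pr x y) 0 \<in> S \<and> (\<forall>m<y. \<exists>v. triple k (pr x m) (Suc v) \<in> S)"
      using J 6 unfolding justified_def Let_def k_def[symmetric] r_def[symmetric] by simp
    have P: "program_of e = (if r = 0 then Tuple (program_of (pfst k)) (program_of (psnd k))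
            else if r = 1 then Comp (program_of (pfst k)) (program_of (psnd k))
            else if r = 2 then PrimRec (program_of (pfst k)) (program_of (psnd k))
            else Minimize (program_of k))"
      unfolding program_of_step[OF 6] Let_def k_def r_def by simp
    consider "r = 0" | "r = 1" | "r = 2" | "r \<noteq> 0" "r \<noteq> 1" "r \<noteq> 2" by blast
    then show ?thesis
    proof cases
      case 1
      then have "triple (pfst k) x (pfst y) \<in> S" "triple (psnd k) x (psnd y) \<in> S" using J' by auto
      from IH[OF this(1)] IH[OF this(2)] show ?thesis using less P 1 by simp
    next
      case 2
      then obtain u where "triple (psnd k) x u \<in> S" "triple (pfst k) u y \<in> S" using J' by auto
      from IH[OF this(1)] IH[OF this(2)] show ?thesis using less P 2 by simp
    next
      case 3
      show ?thesis
      proof (cases "psnd x")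
        case 0
        then have x: "x = pr (pfst x) 0" by (metis pr_eta)
        have "triple (pfst k) (pfst x) y \<in> S" using J' 3 0 by simp
        from IH[OF this] less have "run Z (program_of (pfst k)) (pfst x) = Some y" by simp
        then show ?thesis using P 3 run_PrimRec_0 by (subst x) simp
      next
        case (Suc n)
        then have x: "x = pr (pfst x) (Suc n)" by (metis pr_eta)
        obtain v where v: "triple e (pr (pfst x) n) v \<in> S" "triple (psnd k) (pr (pfst x) (pr n v)) y \<in> S"
          using J' 3 Suc by auto
        have "pr (pfst x) n < x" using pr_strict_mono_right[of n "Suc n" "pfst x"] x by simp
        from IH[OF v(1)] this have "run Z (program_of e) (pr (pfst x) n) = Some v" by simp
        moreover from IH[OF v(2)] less
        have "run Z (program_of (psnd k)) (pr (pfst x) (pr n v)) = Some y" by simp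
        ultimately show ?thesis using P 3 by (subst x) (simp del: run.simps add: run_PrimRec_Suc)
      qed
    next
      case 4
      then have y: "triple k (pr x y) 0 \<in> S" "\<And>m. m < y \<Longrightarrow> \<exists>v. triple k (pr x m) (Suc v) \<in> S"
        using J' by auto
      define st where "st n \<longleftrightarrow> run Z (program_of k) (pr x n) = Some 0 \<and>
         (\<forall>m<n. \<exists>v. run Z (program_of k) (pr x m) = Some (Suc v))" for n
      have "run Z (program_of k) (pr x y) = Some 0" using IH[OF y(1)] less by simp
      moreover have "\<exists>v. run Z (program_of k) (pr x m) = Some (Suc v)" if "m < y" for m
        using y(2)[OF that] IH less by blast
      ultimately have "st y" unfolding st_def by blast
      moreover have "n = y" if "st n" for n
      proof (rule linorder_cases[of n y])
        assume "n < y"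
        then obtain v where "run Z (program_of k) (pr x n) = Some (Suc v)"
          using \<open>st y\<close> unfolding st_def by blast
        then show ?thesis using \<open>st n\<close> unfolding st_def by simp
      next
        assume "y < n"
        then obtain v where "run Z (program_of k) (pr x y) = Some (Suc v)"
          using \<open>st n\<close> unfolding st_def by blast
        then show ?thesis using \<open>st y\<close> unfolding st_def by simp
      qed
      ultimately have "\<exists>n. st n" "(LEAST n. st n) = y" by (blast, metis LeastI)
      moreover have "run Z (Minimize (program_of k)) x = (if \<exists>n. st n then Some (LEAST n. st n) else None)"
        unfolding st_def[abs_def] by (simp add: Let_def)
      moreover have "program_of e = Minimize (program_of k)" using P 4 by simp
      ultimately show ?thesis by (simp only: if_True)
    qed
  qed (use J in \<open>auto simp: justified_def program_of_base\<close>)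
qed

text \<open>
  Unions of closed traces are closed, so the traces of the finitely many subcomputations can be
  merged and the new claim added.
\<close>

lemma trace_complete:
  assumes "run Z (program_of e) x = Some y"
  shows "\<exists>S. finite S \<and> closed_trace S \<and> queries_ok Z Z S \<and> triple e x y \<in> S"
  using assms
proof (induction e arbitrary: x y rule: less_induct)
  case (less e)
  define good where "good S \<longleftrightarrow> finite S \<and> closed_trace S \<and> queries_ok Z Z S" for S
  have good_Un: "good S \<Longrightarrow> good T \<Longrightarrow> good (S \<union> T)" for S T
    unfolding good_def by (simp add: closed_trace_Un queries_ok_Un)
  have good_insert: "\<exists>S. good S \<and> triple e x y \<in> S"
    if "good T" "justified T e x y" "e \<noteq> 4" for T x y
    using that unfolding good_def
    by (intro exI[of _ "insert (triple e x y) T"])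
       (auto intro!: closed_trace_insert queries_ok_insert intro: justified_mono)
  have good_empty: "good {}" unfolding good_def closed_trace_def queries_ok_def by simp
  define k where "k = (e - 5) div 4"
  define r where "r = (e - 5) mod 4"
  consider "e = 0" | "e = 1" | "e = 2" | "e = 3" | "e = 4" | "5 \<le> e" by linarith
  then have "\<exists>S. good S \<and> triple e x y \<in> S"
  proof cases
    case 5
    then have "y = of_bool (x \<in> Z)" using less.prems by (simp add: program_of_base)
    then show ?thesis using 5 unfolding good_def
      by (intro exI[of _ "{triple 4 x y}"])
         (auto simp: closed_trace_def queries_ok_def justified_def)
  next
    case 6
    note less_e = sub_index_less[OF 6, folded k_def]
    have IH: "\<exists>S. good S \<and> triple e' x' y' \<in> S"
      if "e' < e" "run Z (program_of e') x' = Some y'" for e' x' y'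
      using less.IH[OF that] unfolding good_def by blast
    have J: "justified S e x y \<longleftrightarrow> (if r = 0 then triple (pfst k) x (pfst y) \<in> S \<and> triple (psnd k) x (psnd y) \<in> S
     else if r = 1 then \<exists>u. triple (psnd k) x u \<in> S \<and> triple (pfst k) u y \<in> S
     else if r = 2 then
       (if psnd x = 0 then triple (pfst k) (pfst x) y \<in> S
        else \<exists>v. triple e (pr (pfst x) (psnd x - 1)) v \<in> S \<and>
                 triple (psnd k) (pr (pfst x) (pr (psnd x - 1) v)) y \<in> S)
     else triple k (pr x y) 0 \<in> S \<and> (\<forall>m<y. \<exists>v. triple k (pr x m) (Suc v) \<in> S))" for S x y
      using 6 unfolding justified_def Let_def k_def[symmetric] r_def[symmetric] by simp
    have P: "program_of e = (if r = 0 then Tuple (program_of (pfst k)) (program_of (psnd k))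
            else if r = 1 then Comp (program_of (pfst k)) (program_of (psnd k))
            else if r = 2 then PrimRec (program_of (pfst k)) (program_of (psnd k))
            else Minimize (program_of k))"
      unfolding program_of_step[OF 6] Let_def k_def r_def by simp
    have "e \<noteq> 4" using 6 by simp
    consider "r = 0" | "r = 1" | "r = 2" | "r \<noteq> 0" "r \<noteq> 1" "r \<noteq> 2" by blast
    then show ?thesis
    proof cases
      case 1
      then obtain u v where uv: "run Z (program_of (pfst k)) x = Some u" "run Z (program_of (psnd k)) x = Some v" "y = pr u v"
        using less.prems P by (auto simp: bind_eq_Some_conv)
      obtain S T where "good S" "triple (pfst k) x u \<in> S" "good T" "triple (psnd k) x v \<in> T"
        using IH[OF less_e(2) uv(1)] IH[OF less_e(3) uv(2)] by blast
      then show ?thesis using 1 uv \<open>e \<noteq> 4\<close>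
        by (intro good_insert[of "S \<union> T"]) (auto simp: J good_Un)
    next
      case 2
      then obtain u where u: "run Z (program_of (psnd k)) x = Some u" "run Z (program_of (pfst k)) u = Some y"
        using less.prems P by (auto simp: bind_eq_Some_conv)
      obtain S T where "good S" "triple (psnd k) x u \<in> S" "good T" "triple (pfst k) u y \<in> T"
        using IH[OF less_e(3) u(1)] IH[OF less_e(2) u(2)] by blast
      then show ?thesis using 2 \<open>e \<noteq> 4\<close>
        by (intro good_insert[of "S \<union> T"]) (auto simp: J good_Un)
    next
      case 3
      have "\<exists>S. good S \<and> triple e (pr a n) v \<in> S" if "run Z (program_of e) (pr a n) = Some v" for a n v
        using that
      proof (induction n arbitrary: v)
        case 0
        then have "run Z (program_of (pfst k)) a = Some v"
          using P 3 run_PrimRec_0 by simp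
        then obtain S where "good S" "triple (pfst k) a v \<in> S" using IH[OF less_e(2)] by blast
        then show ?case using 3 \<open>e \<noteq> 4\<close> by (intro good_insert[of S]) (auto simp: J)
      next
        case (Suc n)
        then obtain u where u: "run Z (program_of e) (pr a n) = Some u"
          "run Z (program_of (psnd k)) (pr a (pr n u)) = Some v"
          using P 3 by (auto simp del: run.simps simp: run_PrimRec_Suc bind_eq_Some_conv)
        obtain S T where "good S" "triple e (pr a n) u \<in> S" "good T" "triple (psnd k) (pr a (pr n u)) v \<in> T"
          using IH[OF less_e(3) u(2)] Suc.IH[OF u(1)] by blast
        then show ?case using 3 \<open>e \<noteq> 4\<close>
          by (intro good_insert[of "S \<union> T"]) (auto simp: J good_Un)
      qed
      from this[of "pfst x" "psnd x" y] less.prems show ?thesis by simp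
    next
      case 4
      define st where "st n \<longleftrightarrow> run Z (program_of k) (pr x n) = Some 0 \<and>
         (\<forall>m<n. \<exists>v. run Z (program_of k) (pr x m) = Some (Suc v))" for n
      have "run Z (Minimize (program_of k)) x = (if \<exists>n. st n then Some (LEAST n. st n) else None)"
        unfolding st_def[abs_def] by (simp add: Let_def)
      moreover have "program_of e = Minimize (program_of k)" using P 4 by simp
      ultimately have "(if \<exists>n. st n then Some (LEAST n. st n) else None) = Some y"
        using less.prems by (simp only:)
      then have "st y" by (auto split: if_splits intro: LeastI)
      obtain S where S: "good S" "triple k (pr x y) 0 \<in> S"
        using IH[OF less_e(1)] \<open>st y\<close> unfolding st_def by blast
      have "\<forall>m. m < y \<longrightarrow> (\<exists>v S. good S \<and> triple k (pr x m) (Suc v) \<in> S)"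
        using \<open>st y\<close> IH[OF less_e(1)] unfolding st_def by blast
      then obtain v T where T: "\<And>m. m < y \<Longrightarrow> good (T m) \<and> triple k (pr x m) (Suc (v m)) \<in> T m"
        by metis
      have "good (\<Union>m\<in>{..<y}. T m)"
        using T unfolding good_def by (auto intro!: closed_trace_UN queries_ok_UN)
      with S(1) have "good (S \<union> (\<Union>m\<in>{..<y}. T m))" by (rule good_Un)
      then show ?thesis
        by (rule good_insert) (use S(2) T 4 \<open>e \<noteq> 4\<close> in \<open>auto simp: J\<close>)
    qed
  next
    case 1
    then show ?thesis using less.prems
      by (intro good_insert[OF good_empty]) (auto simp: justified_def program_of_base)
  next
    case 2
    then show ?thesis using less.prems
      by (intro good_insert[OF good_empty]) (auto simp: justified_def program_of_base)
  next
    case 3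
    then show ?thesis using less.prems
      by (intro good_insert[OF good_empty]) (auto simp: justified_def program_of_base)
  next
    case 4
    then show ?thesis using less.prems
      by (intro good_insert[OF good_empty]) (auto simp: justified_def program_of_base)
  qed
  then show ?case unfolding good_def by blast
qed

theorem run_iff_trace:
  "run Z (program_of e) x = Some y \<longleftrightarrow>
     (\<exists>S. finite S \<and> closed_trace S \<and> queries_ok Z Z S \<and> triple e x y \<in> S)"
  by (rule iffI, erule trace_complete) (auto intro: trace_sound)

section \<open>Jumps, limits and a fixed point\<close>

lemma set_decode_iff_bit: "n \<in> set_decode L \<longleftrightarrow> bit L n"
  by (simp add: set_decode_def bit_iff_odd)

lemma dec_set_decode [computability]:
  "computable_in Z f \<Longrightarrow> computable_in Z g \<Longrightarrow> decidable_in Z (\<lambda>x. f x \<in> set_decode (g x))"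
  unfolding set_decode_iff_bit by (rule dec_bit)

lemma set_decode_le: "n \<in> set_decode L \<Longrightarrow> n \<le> L"
proof -
  assume "n \<in> set_decode L"
  then have "L div 2 ^ n \<noteq> 0" unfolding set_decode_def by (auto intro: Nat.gr0I)
  then have "2 ^ n \<le> L" by (simp add: div_eq_0_iff not_less)
  with less_exp[of n] show ?thesis by linarith
qed

lemma triple_le:
  assumes "triple e x y \<in> set_decode L"
  shows "e \<le> L" "x \<le> L" "y \<le> L"
  using set_decode_le[OF assms] le_prod_encode_1[of e "pr x y"] le_prod_encode_2[of "pr x y" e]
    le_prod_encode_1[of x y] le_prod_encode_2[of y x] by linarith+

text \<open>
  The numbers sought by the existential quantifiers occur in claims of the trace, hence are bounded
  by its code. This makes justification decidable.
\<close>

lemma justified_bounded: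
  "justified (set_decode L) e x y \<longleftrightarrow>
     (if e = 0 then y = 0
     else if e = 1 then y = Suc x
     else if e = 2 then y = pfst x
     else if e = 3 then y = psnd x
     else if e = 4 then y \<le> 1
     else if (e - 5) mod 4 = 0 then triple (pfst ((e - 5) div 4)) x (pfst y) \<in> set_decode L \<and>
        triple (psnd ((e - 5) div 4)) x (psnd y) \<in> set_decode L
     else if (e - 5) mod 4 = 1 then
        \<exists>u\<le>L. triple (psnd ((e - 5) div 4)) x u \<in> set_decode L \<and>
              triple (pfst ((e - 5) div 4)) u y \<in> set_decode L
     else if (e - 5) mod 4 = 2 then
       (if psnd x = 0 then triple (pfst ((e - 5) div 4)) (pfst x) y \<in> set_decode L
        else \<exists>v\<le>L. triple e (pr (pfst x) (psnd x - 1)) v \<in> set_decode L \<and>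
                 triple (psnd ((e - 5) div 4)) (pr (pfst x) (pr (psnd x - 1) v)) y \<in> set_decode L)
     else triple ((e - 5) div 4) (pr x y) 0 \<in> set_decode L \<and>
        (\<forall>m<y. \<exists>v\<le>L. triple ((e - 5) div 4) (pr x m) (Suc v) \<in> set_decode L))"
proof -
  have *: "(\<exists>u. Q u) \<longleftrightarrow> (\<exists>u\<le>L. Q u)" if "\<And>u. Q u \<Longrightarrow> u \<le> L" for Q
    using that by blast
  have 1: "(\<exists>u. triple b x u \<in> set_decode L \<and> triple a u y \<in> set_decode L) \<longleftrightarrow>
    (\<exists>u\<le>L. triple b x u \<in> set_decode L \<and> triple a u y \<in> set_decode L)" for a b
    by (rule *) (auto dest: triple_le)
  have 2: "(\<exists>v. triple a' x' v \<in> set_decode L \<and> triple b (pr x'' (pr n v)) y \<in> set_decode L) \<longleftrightarrow>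
    (\<exists>v\<le>L. triple a' x' v \<in> set_decode L \<and> triple b (pr x'' (pr n v)) y \<in> set_decode L)" for a' x' x'' b n
    by (rule *) (auto dest: triple_le)
  have 3: "(\<exists>v. triple k (pr x m) (Suc v) \<in> set_decode L) \<longleftrightarrow>
    (\<exists>v\<le>L. triple k (pr x m) (Suc v) \<in> set_decode L)" for k m
    by (rule *) (auto dest: triple_le(3))
  show ?thesis unfolding justified_def Let_def 1 2 3 ..
qed

lemma dec_closed_trace [computability]:
  assumes "computable_in Z f"
  shows "decidable_in Z (\<lambda>x. closed_trace (set_decode (f x)))"
proof (rule decidable_in_comp[OF _ assms])
  have "closed_trace (set_decode L) \<longleftrightarrow>
    (\<forall>e\<le>L. \<forall>x\<le>L. \<forall>y\<le>L. triple e x y \<in> set_decode L \<longrightarrow> justified (set_decode L) e x y)" for L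
    unfolding closed_trace_def using triple_le by blast
  moreover have "decidable_in Z (\<lambda>L. \<forall>e\<le>L. \<forall>x\<le>L. \<forall>y\<le>L.
      triple e x y \<in> set_decode L \<longrightarrow> justified (set_decode L) e x y)"
    unfolding justified_bounded by (intro computability)
  ultimately show "decidable_in Z (\<lambda>L. closed_trace (set_decode L))" by simp
qed

lemma dec_queries_ok:
  assumes "decidable_in Z (\<lambda>y. psnd y \<in> P (pfst y))" "decidable_in Z (\<lambda>y. psnd y \<in> N (pfst y))"
    "computable_in Z f"
  shows "decidable_in Z (\<lambda>x. queries_ok (P x) (N x) (set_decode (f x)))"
proof -
  have "queries_ok (P x) (N x) (set_decode (f x)) \<longleftrightarrow>
     (\<forall>m\<le>f x. (triple 4 m 0 \<in> set_decode (f x) \<longrightarrow> m \<notin> N x) \<and>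
       (triple 4 m 1 \<in> set_decode (f x) \<longrightarrow> m \<in> P x))" for x
    unfolding queries_ok_def by (auto dest: triple_le)
  moreover have "decidable_in Z (\<lambda>x. \<forall>m\<le>f x. (triple 4 m 0 \<in> set_decode (f x) \<longrightarrow> m \<notin> N x) \<and>
       (triple 4 m 1 \<in> set_decode (f x) \<longrightarrow> m \<in> P x))"
    by (intro computability assms computable_in_comp[OF assms(3)])
  ultimately show ?thesis by simp
qed

text \<open>
  The number \<open>L\<close>, read as a finite set, codes a halting computation. Unlike halting itself, this is
  decidable relative to \<open>P\<close> and \<open>N\<close>.
\<close>

definition halts :: "nat set \<Rightarrow> nat set \<Rightarrow> nat \<Rightarrow> nat \<Rightarrow> nat \<Rightarrow> bool" where
  "halts P N e x L \<longleftrightarrow> closed_trace (set_decode L) \<and> queries_ok P N (set_decode L) \<and>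
     (\<exists>y\<le>L. triple e x y \<in> set_decode L)"

lemma dec_halts:
  assumes "decidable_in Z (\<lambda>y. psnd y \<in> P (pfst y))" "decidable_in Z (\<lambda>y. psnd y \<in> N (pfst y))"
    "computable_in Z e" "computable_in Z g" "computable_in Z f"
  shows "decidable_in Z (\<lambda>x. halts (P x) (N x) (e x) (g x) (f x))"
  unfolding halts_def
  by (intro computability dec_queries_ok assms assms(3-5)[THEN computable_in_comp])

lemma run_iff_halts:
  "run Z (program_of e) x = Some y \<longleftrightarrow> (\<exists>L. halts Z Z e x L \<and> triple e x y \<in> set_decode L)"
proof -
  have "(\<exists>S. finite S \<and> Q S) \<longleftrightarrow> (\<exists>L. Q (set_decode L))" for Q
    by (metis finite_set_decode set_encode_inverse)
  then have "run Z (program_of e) x = Some y \<longleftrightarrow> (\<exists>L. closed_trace (set_decode L) \<and>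
      queries_ok Z Z (set_decode L) \<and> triple e x y \<in> set_decode L)"
    unfolding run_iff_trace .
  also have "\<dots> \<longleftrightarrow> (\<exists>L. halts Z Z e x L \<and> triple e x y \<in> set_decode L)"
    unfolding halts_def by (intro ex_cong1) (auto dest: triple_le)
  finally show ?thesis .
qed

lemma halts_iff_run: "(\<exists>L. halts Z Z e x L) \<longleftrightarrow> run Z (program_of e) x \<noteq> None"
proof -
  have "halts Z Z e x L \<Longrightarrow> \<exists>y. triple e x y \<in> set_decode L" for L unfolding halts_def by blast
  then show ?thesis using run_iff_halts[of Z e x] by (metis not_None_eq)
qed

definition re_stage :: "nat set \<Rightarrow> nat \<Rightarrow> nat \<Rightarrow> nat set" where
  "re_stage Z a t = {n. \<exists>L\<le>t. halts Z Z a n L}"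

lemma re_stage_mono: "s \<le> t \<Longrightarrow> re_stage Z a s \<subseteq> re_stage Z a t"
  unfolding re_stage_def by (auto intro: order_trans)

lemma dec_re_stage:
  assumes "computable_in Z e" "computable_in Z f" "computable_in Z g"
  shows "decidable_in Z (\<lambda>x. g x \<in> re_stage Z (e x) (f x))"
  unfolding re_stage_def mem_Collect_eq
  by (intro computability dec_halts dec_oracle assms assms[THEN computable_in_comp])

lemma jump_approx:
  obtains J where "decidable_in Z (\<lambda>y. psnd y \<in> J (pfst y))"
    "\<And>m. \<forall>\<^sub>F s in sequentially. m \<in> J s \<longleftrightarrow> m \<in> jump Z"
proof
  define J where "J s = {m. m \<in> re_stage Z m s}" for s
  show "decidable_in Z (\<lambda>y. psnd y \<in> J (pfst y))"
    unfolding J_def mem_Collect_eq by (intro computability dec_re_stage)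
  fix m
  show "\<forall>\<^sub>F s in sequentially. m \<in> J s \<longleftrightarrow> m \<in> jump Z"
  proof (cases "m \<in> jump Z")
    case True
    then obtain L where "halts Z Z m m L" unfolding jump_def halts_iff_run[symmetric] by auto
    then have "\<forall>s\<ge>L. m \<in> J s" unfolding J_def re_stage_def by auto
    then show ?thesis using True unfolding eventually_sequentially by blast
  next
    case False
    then have "\<not> halts Z Z m m L" for L unfolding jump_def using halts_iff_run[of Z m m] by auto
    then show ?thesis using False unfolding J_def re_stage_def by simp
  qed
qed

text \<open>
  Run the computation with the stage approximations to the jump in place of the jump. The least trace
  that is correct for the jump asks only finitely many queries, and so do the smaller numbers, none of
  which codes a correct trace; once the answers to these queries have settled, the least trace that looks
  correct is the correct one.
\<close>

theorem limit_lemma: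
  assumes "computable_in (jump Z) f"
  obtains g where "computable_in Z g" "\<And>x. \<forall>\<^sub>F s in sequentially. g (pr x s) = f x"
proof -
  obtain p where p: "\<And>x. run (jump Z) p x = Some (f x)" using assms unfolding computable_in_def by blast
  obtain e where e: "program_of e = p" using surj_program_of by (metis surjD)
  obtain J where J: "decidable_in Z (\<lambda>y. psnd y \<in> J (pfst y))"
    "\<And>m. \<forall>\<^sub>F s in sequentially. m \<in> J s \<longleftrightarrow> m \<in> jump Z" using jump_approx by blast
  define tr where "tr x s = (LEAST L. halts (J s) (J s) e x L \<or> s \<le> L)" for x s
  define out where "out x L = (LEAST y. triple e x y \<in> set_decode L \<or> L \<le> y)" for x L
  define g where "g y = out (pfst y) (tr (pfst y) (psnd y))" for y
  have J2: "decidable_in Z (\<lambda>x. h x \<in> J (k x))" if "computable_in Z h" "computable_in Z k" for h k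
    by (rule decidable_in_comp2[of Z "\<lambda>a b. b \<in> J a"]) (use J(1) that in auto)
  have tr: "computable_in Z (\<lambda>y. tr (pfst y) (psnd y))" unfolding tr_def
    by (rule comp_Least, intro computability dec_halts J2) (rule exI, rule disjI2, rule order_refl)
  have "computable_in Z (\<lambda>y. out (pfst y) (psnd y))" unfolding out_def
    by (rule comp_Least, intro computability) (rule exI, rule disjI2, rule order_refl)
  from computable_in_comp2[OF this comp_pfst[OF comp_id] tr] have "computable_in Z g"
    unfolding g_def[abs_def] .
  moreover have "\<forall>\<^sub>F s in sequentially. g (pr x s) = f x" for x
  proof -
    let ?H = "halts (jump Z) (jump Z) e x"
    have ex: "\<exists>L. ?H L" using p[of x] halts_iff_run[of "jump Z" e x] e by simp
    define l where "l = (LEAST L. ?H L)"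
    have l: "?H l" unfolding l_def using ex by (rule LeastI_ex)
    have l_min: "\<not> ?H L" if "L < l" for L using that unfolding l_def by (rule not_less_Least)
    have out: "out x l = f x"
      unfolding out_def
    proof (rule Least_equality)
      obtain y where y: "triple e x y \<in> set_decode l" using l unfolding halts_def by blast
      have unique: "y' = f x" if "triple e x y' \<in> set_decode l" for y'
        using run_iff_halts[of "jump Z" e x y'] l that p[of x] e by auto
      show "triple e x (f x) \<in> set_decode l \<or> l \<le> f x" using y unique by blast
      show "f x \<le> y'" if "triple e x y' \<in> set_decode l \<or> l \<le> y'" for y'
        using that unique triple_le(3)[OF y] y by fastforce
    qed
    have "\<forall>\<^sub>F s in sequentially. \<forall>m\<in>{..l}. m \<in> J s \<longleftrightarrow> m \<in> jump Z"
      using J(2) by (intro eventually_ball_finite) auto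
    moreover have "\<forall>\<^sub>F s in sequentially. l < s" by (rule eventually_gt_at_top)
    ultimately show ?thesis
    proof eventually_elim
      case (elim s)
      have eq: "halts (J s) (J s) e x L \<longleftrightarrow> ?H L" if "L \<le> l" for L
      proof -
        have "queries_ok (J s) (J s) (set_decode L) \<longleftrightarrow> queries_ok (jump Z) (jump Z) (set_decode L)"
          unfolding queries_ok_def using elim that triple_le(2)[of 4 _ _ L] by (meson atMost_iff order_trans)
        then show ?thesis unfolding halts_def by simp
      qed
      have "tr x s = l" unfolding tr_def
      proof (rule Least_equality)
        show "halts (J s) (J s) e x l \<or> s \<le> l" using eq l by blast
        show "l \<le> L" if "halts (J s) (J s) e x L \<or> s \<le> L" for L
        proof (rule ccontr)
          assume "\<not> l \<le> L"
          then show False using that eq[of L] l_min[of L] elim by auto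
        qed
      qed
      then show ?case unfolding g_def using out by simp
    qed
  qed
  ultimately show ?thesis by (rule that)
qed

definition const_index :: "nat \<Rightarrow> nat" where
  "const_index n = rec_nat 0 (\<lambda>_ v. 4 * pr 1 v + 6) n"

lemma program_of_Comp: "program_of (4 * pr a b + 6) = Comp (program_of a) (program_of b)"
proof -
  have "(4 * k + 1) div 4 = k" "(4 * k + 1) mod 4 = 1" for k :: nat by presburger+
  then show ?thesis by (subst program_of_step) (auto simp: Let_def)
qed

lemma run_const_index: "run Z (program_of (const_index n)) x = Some n"
proof (induction n)
  case 0
  show ?case by (simp add: const_index_def program_of_base)
next
  case (Suc n)
  have "const_index (Suc n) = 4 * pr 1 (const_index n) + 6" by (simp add: const_index_def)
  then show ?case using Suc program_of_base(2) by (simp only: program_of_Comp) simp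
qed

definition smn :: "nat \<Rightarrow> nat \<Rightarrow> nat" where
  "smn x c = 4 * pr x (const_index c) + 6"

text \<open>
  The index \<open>smn x c\<close> ignores its input and runs program \<open>x\<close> on \<open>c\<close>. In particular its membership
  in the jump, which refers to the input \<open>smn x c\<close> itself, only depends on the run of \<open>x\<close> on \<open>c\<close>.
\<close>

lemma run_smn: "run Z (program_of (smn x c)) y = run Z (program_of x) c"
  unfolding smn_def program_of_Comp by (simp add: run_const_index)

lemma comp_smn [computability]:
  assumes "computable_in Z f" "computable_in Z g"
  shows "computable_in Z (\<lambda>x. smn (f x) (g x))"
  unfolding smn_def const_index_def by (intro computability assms)

lemma re_le_jump:
  assumes "decidable_in Z D"
  obtains f where "computable_in {} f" "\<And>u. f u \<in> jump Z \<longleftrightarrow> (\<exists>t. D (pr u t))"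
proof -
  obtain p where p: "\<And>y. run Z p y = Some (of_bool (\<not> D y))"
    using dec_not[OF assms] unfolding decidable_in_def computable_in_def by blast
  obtain e where e: "program_of e = Minimize p" using surj_program_of by (metis surjD)
  have "smn e u \<in> jump Z \<longleftrightarrow> (\<exists>t. D (pr u t))" for u
    unfolding jump_def mem_Collect_eq run_smn e Minimize_eq[OF p] by auto
  moreover have "computable_in {} (smn e)" by (intro computability)
  ultimately show ?thesis using that by blast
qed

text \<open>
  A \<open>\<Pi>\<^sub>2\<close> family over \<open>A\<close> whose parameter \<open>x\<close> is the index of a program that semidecides the
  complement of that same family from the jump of \<open>A\<close>.
  This allows a construction to consult a limit approximation to the truth of statements about that
  same construction. It is a diagonal argument: the program with index \<open>x\<close>, which receives \<open>x\<close> itself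
  as part of its input, searches for a counterexample \<open>v\<close>.
\<close>

theorem Pi2_fixed_point:
  assumes "decidable_in A D"
  obtains x where "\<And>e. smn x (pr x e) \<in> jump (jump A) \<longleftrightarrow> \<not> (\<forall>v. \<exists>t. D (pr (pr (pr x e) v) t))"
proof -
  obtain f where f: "computable_in {} f" "\<And>u. f u \<in> jump A \<longleftrightarrow> (\<exists>t. D (pr u t))"
    using re_le_jump[OF assms] by blast
  have "decidable_in (jump A) (\<lambda>u. f u \<notin> jump A)"
    by (rule dec_not[OF dec_oracle[OF computable_in_mono[OF f(1)]]])
  then obtain p where p: "\<And>y. run (jump A) p y = Some (of_bool (\<not> f y \<notin> jump A))"
    using dec_not[of "jump A" "\<lambda>u. f u \<notin> jump A"] unfolding decidable_in_def computable_in_def by blast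
  obtain x where x: "program_of x = Minimize p" using surj_program_of by (metis surjD)
  have "smn x (pr x e) \<in> jump (jump A) \<longleftrightarrow> \<not> (\<forall>v. \<exists>t. D (pr (pr (pr x e) v) t))" for e
    unfolding jump_def[of "jump A"] mem_Collect_eq run_smn x Minimize_eq[OF p] by (auto simp: f(2))
  then show ?thesis using that by blast
qed

text \<open>
  A reduction of the double jump of \<open>A\<close> to that of the empty set computes membership from
  the double jump of the empty set; each application of the limit lemma trades one jump for a limit.
\<close>

theorem low2_approx:
  assumes "low2 A"
  obtains r where "computable_in {} r"
    "\<And>z. \<forall>\<^sub>F s in sequentially. \<forall>\<^sub>F t in sequentially. r (pr (pr z s) t) = of_bool (z \<in> jump (jump A))"
proof -
  have "computable_in (jump (jump {})) (\<lambda>z. of_bool (z \<in> jump (jump A)))"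
    using assms unfolding low2_def turing_equiv_def turing_le_def computable_in_def by blast
  then obtain g where g: "computable_in (jump {}) g"
    "\<And>z. \<forall>\<^sub>F s in sequentially. g (pr z s) = of_bool (z \<in> jump (jump A))"
    using limit_lemma by blast
  obtain r where r: "computable_in {} r" "\<And>y. \<forall>\<^sub>F t in sequentially. r (pr y t) = g y"
    using limit_lemma[OF g(1)] by blast
  have "\<forall>\<^sub>F s in sequentially. \<forall>\<^sub>F t in sequentially. r (pr (pr z s) t) = of_bool (z \<in> jump (jump A))" for z
    using g(2)[of z]
  proof eventually_elim
    case (elim s)
    show ?case using r(2)[of "pr z s"] elim by simp
  qed
  with r(1) show ?thesis using that by blast
qed

section \<open>Witnesses for density at stages of an enumeration\<close>

text \<open>
  Strings under construction are represented by a length and a number that holds the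
  bits, so that appending is the arithmetic operation \<open>m + 2 ^ l * u\<close>.
\<close>

definition bits :: "nat \<Rightarrow> nat \<Rightarrow> bool list" where
  "bits k m = map (bit m) [0..<k]"

text \<open>
  The list is built from its end, which exhibits its code as a primitive recursion.
\<close>

lemma string_code_bits:
  "string_code (bits k m) = rec_nat 0 (\<lambda>i v. Suc (pr (of_bool (bit m (k - Suc i))) v)) k"
proof -
  have "rec_nat 0 (\<lambda>i v. Suc (pr (of_bool (bit m (k - Suc i))) v)) j
      = list_encode (map of_bool (map (bit m) [k - j..<k]))" if "j \<le> k" for j
    using that
  proof (induction j)
    case (Suc j)
    then have "[k - Suc j..<k] = (k - Suc j) # [k - j..<k]"
      by (metis Suc_diff_Suc Suc_le_lessD diff_less upt_conv_Cons zero_less_Suc order_less_le_trans zero_less_diff less_imp_Suc_add)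
    then show ?case using Suc by simp
  qed simp
  from this[of k] show ?thesis by (simp add: string_code_def bits_def)
qed

lemma comp_string_code_bits [computability]:
  assumes "computable_in Z f" "computable_in Z g"
  shows "computable_in Z (\<lambda>x. string_code (bits (f x) (g x)))"
  unfolding string_code_bits
  by (intro computability assms assms[THEN computable_in_comp])

lemma string_code_inject: "string_code \<sigma> = string_code \<tau> \<longleftrightarrow> \<sigma> = \<tau>"
proof -
  have "inj (of_bool :: bool \<Rightarrow> nat)" by (auto simp: inj_def)
  then show ?thesis unfolding string_code_def by (simp add: list_encode_eq inj_map_eq_map)
qed

lemma bit_concat:
  assumes "m < 2 ^ l"
  shows "bit (m + 2 ^ l * u :: nat) i \<longleftrightarrow> (if i < l then bit m i else bit u (i - l))"
proof (cases "i < l")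
  case True
  then obtain j where l: "l = i + Suc j" by (metis add_Suc_right less_imp_Suc_add)
  have "2 ^ l * u = 2 ^ i * (2 * (2 ^ j * u))" unfolding l by (simp add: power_add)
  then have "(m + 2 ^ l * u) div 2 ^ i = (m + 2 ^ i * (2 * (2 ^ j * u))) div 2 ^ i"
    by (simp only:)
  also have "\<dots> = 2 * (2 ^ j * u) + m div 2 ^ i" by (rule div_mult_self2) simp
  finally show ?thesis using True by (simp add: bit_iff_odd)
next
  case False
  then obtain j where i: "i = l + j" by (metis le_Suc_ex not_less)
  have "(m + 2 ^ l * u) div 2 ^ i = (m + 2 ^ l * u) div 2 ^ l div 2 ^ j"
    unfolding i by (simp add: power_add div_mult2_eq)
  also have "(m + 2 ^ l * u) div 2 ^ l = u" using assms by simp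
  finally show ?thesis using False i by (simp add: bit_iff_odd)
qed

lemma length_bits [simp]: "length (bits k m) = k" by (simp add: bits_def)

lemma bits_concat:
  assumes "m < 2 ^ l"
  shows "bits (l + k) (m + 2 ^ l * u) = bits l m @ bits k u"
  by (rule nth_equalityI) (auto simp: bits_def bit_concat[OF assms] nth_append)

lemma take_bits: "k \<le> n \<Longrightarrow> take k (bits n m) = bits k m"
  by (rule nth_equalityI) (auto simp: bits_def)

text \<open>
  The number \<open>u\<close> may be taken at least as large as the length of \<open>\<tau>\<close>. Therefore a chunk to be
  appended need not record its length: \<open>u\<close> itself serves as the length.
\<close>

lemma bits_surj: "\<exists>u. bits (length \<tau>) u = \<tau> \<and> length \<tau> \<le> u"
proof -
  let ?v = "horner_sum of_bool 2 \<tau> :: nat"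
  \<comment> \<open>a leading 1 above the bits of \<open>\<tau>\<close> makes the number large\<close>
  let ?u = "?v + 2 ^ length \<tau> * 1"
  have "?v < 2 ^ length \<tau>" by (rule horner_sum_of_bool_2_less)
  then have "bits (length \<tau>) ?u = \<tau>"
    unfolding bits_def using bit_concat[of ?v "length \<tau>" 1]
    by (intro nth_equalityI) (simp_all add: bit_horner_sum_bit_iff)
  moreover have "length \<tau> \<le> ?u" using less_exp[of "length \<tau>"] by linarith
  ultimately show ?thesis by blast
qed

text \<open>
  Treat the strings of \<open>S\<close> one after the other, each time lengthening \<open>\<tau>\<close> so that it also leads the
  new string into \<open>W\<close>; this does not harm the earlier ones.
\<close>

lemma uniform_extension:
  assumes "dense_strings W" "finite S"
  shows "\<exists>\<tau>. \<forall>\<sigma>\<in>S. \<exists>\<rho>\<in>W. prefix \<rho> (\<sigma> @ \<tau>)"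
  using assms(2)
proof (induction S rule: finite_induct)
  case (insert \<sigma> S)
  then obtain \<tau> where \<tau>: "\<forall>\<sigma>\<in>S. \<exists>\<rho>\<in>W. prefix \<rho> (\<sigma> @ \<tau>)" by blast
  obtain \<rho> where \<rho>: "\<rho> \<in> W" "prefix (\<sigma> @ \<tau>) \<rho>" using assms(1) unfolding dense_strings_def by blast
  then obtain \<nu> where \<nu>: "\<rho> = (\<sigma> @ \<tau>) @ \<nu>" unfolding prefix_def by blast
  have "\<forall>\<sigma>'\<in>insert \<sigma> S. \<exists>\<rho>\<in>W. prefix \<rho> (\<sigma>' @ (\<tau> @ \<nu>))"
    using \<tau> \<rho> \<nu> by (metis append.assoc insert_iff prefix_order.refl prefix_prefix)
  then show ?case by blast
qed simp

lemma uniform_extension_bits: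
  assumes "dense_strings W"
  obtains u where "\<And>l m. l \<le> N \<Longrightarrow> m < 2 ^ l \<Longrightarrow> \<exists>k\<le>l + u. bits k (m + 2 ^ l * u) \<in> W"
proof -
  have "finite ((\<lambda>(l, m). bits l m) ` (SIGMA l:{..N}. {..<2 ^ l}))" by simp
  from uniform_extension[OF assms this] obtain \<tau>
    where \<tau>: "\<And>l m. l \<le> N \<Longrightarrow> m < 2 ^ l \<Longrightarrow> \<exists>\<rho>\<in>W. prefix \<rho> (bits l m @ \<tau>)" by fastforce
  obtain u where u: "bits (length \<tau>) u = \<tau>" "length \<tau> \<le> u" using bits_surj by blast
  have "\<exists>k\<le>l + u. bits k (m + 2 ^ l * u) \<in> W" if lm: "l \<le> N" "m < 2 ^ l" for l m
  proof -
    obtain \<rho> where \<rho>: "\<rho> \<in> W" "prefix \<rho> (bits l m @ \<tau>)" using \<tau> lm by blast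
    have eq: "bits l m @ \<tau> = bits (l + length \<tau>) (m + 2 ^ l * u)" using bits_concat[OF lm(2)] u(1) by simp
    have len: "length \<rho> \<le> l + length \<tau>" using prefix_length_le[OF \<rho>(2)] by simp
    have "\<rho> = take (length \<rho>) (bits l m @ \<tau>)" using \<rho>(2) by (metis append_eq_conv_conj prefixE)
    then have "\<rho> = bits (length \<rho>) (m + 2 ^ l * u)" unfolding eq using take_bits[OF len] by simp
    then show ?thesis using \<rho>(1) len u(2) by (intro exI[of _ "length \<rho>"]) auto
  qed
  then show ?thesis by (rule that)
qed

lemma closed_queries_join:
  assumes "finite I" "\<And>i. i \<in> I \<Longrightarrow> \<exists>L. halts Z Z e (x i) L"
  obtains L where "closed_trace (set_decode L)" "queries_ok Z Z (set_decode L)"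
    "\<And>i. i \<in> I \<Longrightarrow> \<exists>y\<le>L. triple e (x i) y \<in> set_decode L"
proof -
  have "\<forall>i. \<exists>L. i \<in> I \<longrightarrow> halts Z Z e (x i) L" using assms(2) by blast
  then obtain L where L: "\<And>i. i \<in> I \<Longrightarrow> halts Z Z e (x i) (L i)" by metis
  let ?S = "\<Union>i\<in>I. set_decode (L i)"
  let ?L = "set_encode ?S"
  have "finite ?S" using assms(1) by simp
  then have eq: "set_decode ?L = ?S" by (rule set_encode_inverse)
  have "closed_trace ?S" using L unfolding halts_def by (intro closed_trace_UN) blast
  moreover have "queries_ok Z Z ?S" using L unfolding halts_def by (intro queries_ok_UN) blast
  moreover have "\<exists>y\<le>?L. triple e (x i) y \<in> ?S" if i: "i \<in> I" for i
  proof -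
    obtain y where "triple e (x i) y \<in> set_decode (L i)" using L[OF i] unfolding halts_def by blast
    then have "triple e (x i) y \<in> ?S" using i by blast
    then show ?thesis using triple_le(3)[of e "x i" y ?L] eq by auto
  qed
  ultimately show ?thesis using that[of ?L] eq by simp
qed

text \<open>
  A witness is a number \<open>pr s (pr u L)\<close> with a chunk \<open>u\<close> and a trace \<open>L\<close>. The component \<open>s\<close> is padding:
  it makes the witness itself large enough to serve as a stage at which the positive answers
  in \<open>L\<close> have been enumerated.
\<close>

definition ext_of :: "nat \<Rightarrow> nat" where "ext_of w = pfst (psnd w)"
definition trace_of :: "nat \<Rightarrow> nat" where "trace_of w = psnd (psnd w)"

text \<open>
  The trace shows that appending the chunk to any string of length at most \<open>n\<^sup>2\<close> creates a
  prefix in the \<open>e\<close>-th set. The bound \<open>n\<^sup>2\<close> is never below the length that any run of the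
  construction can have reached at stage \<open>n\<close> (\<open>limit_length_growth_le\<close>), so the witness suits all
  sequences that take part in the attempt.
\<close>

definition covers :: "nat \<Rightarrow> nat \<Rightarrow> nat \<Rightarrow> bool" where
  "covers e n w \<longleftrightarrow> (\<forall>l\<le>n * n. \<forall>m<2 ^ l. \<exists>k\<le>l + ext_of w. \<exists>y\<le>trace_of w.
     triple e (string_code (bits k (m + 2 ^ l * ext_of w))) y \<in> set_decode (trace_of w))"

lemma comp_ext_of [computability]: "computable_in Z f \<Longrightarrow> computable_in Z (\<lambda>x. ext_of (f x))"
  unfolding ext_of_def by (intro computability)

lemma comp_trace_of [computability]: "computable_in Z f \<Longrightarrow> computable_in Z (\<lambda>x. trace_of (f x))"
  unfolding trace_of_def by (intro computability)

lemma ext_of_le: "ext_of w \<le> w"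
  unfolding ext_of_def using prod_decode_le order_trans by metis

lemma dec_covers [computability]:
  assumes "computable_in Z e" "computable_in Z n" "computable_in Z w"
  shows "decidable_in Z (\<lambda>x. covers (e x) (n x) (w x))"
  unfolding covers_def
  by (intro computability assms assms[THEN computable_in_comp])

definition witness :: "nat set \<Rightarrow> nat set \<Rightarrow> nat \<Rightarrow> nat \<Rightarrow> nat \<Rightarrow> bool" where
  "witness P N e n w \<longleftrightarrow> closed_trace (set_decode (trace_of w)) \<and>
     queries_ok P N (set_decode (trace_of w)) \<and> covers e n w"

lemma dec_witness:
  assumes "decidable_in Z (\<lambda>y. psnd y \<in> P (pfst y))" "decidable_in Z (\<lambda>y. psnd y \<in> N (pfst y))"
    "computable_in Z e" "computable_in Z n" "computable_in Z w"
  shows "decidable_in Z (\<lambda>x. witness (P x) (N x) (e x) (n x) (w x))"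
  unfolding witness_def
  by (intro computability dec_queries_ok assms assms(3-5)[THEN computable_in_comp])

lemma dec_re_stage_empty:
  assumes "computable_in Z f" "computable_in Z g"
  shows "decidable_in Z (\<lambda>x. g x \<in> re_stage {} a (f x))"
proof -
  have "decidable_in {} (\<lambda>y. psnd y \<in> re_stage {} a (pfst y))"
    by (intro dec_re_stage computability)
  from decidable_in_comp2[where h="\<lambda>s n. n \<in> re_stage {} a s", OF decidable_in_mono[OF this] assms]
  show ?thesis .
qed

definition enumerates :: "nat set \<Rightarrow> nat \<Rightarrow> bool" where
  "enumerates A a \<longleftrightarrow> A = {n. run {} (program_of a) n \<noteq> None}"

lemma enumerates_UN: "enumerates A a \<Longrightarrow> A = (\<Union>t. re_stage {} a t)"
  unfolding enumerates_def re_stage_def halts_iff_run[symmetric] by auto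

text \<open>
  Positive answers are judged at stage \<open>w\<close>, not at the current stage. A witness that fails at some
  stage then never looks correct again.
\<close>

definition true_witness :: "nat set \<Rightarrow> nat \<Rightarrow> nat \<Rightarrow> nat \<Rightarrow> nat \<Rightarrow> bool" where
  "true_witness A a e n w \<longleftrightarrow> witness (re_stage {} a w) A e n w"

definition stage_witness :: "nat \<Rightarrow> nat \<Rightarrow> nat \<Rightarrow> nat \<Rightarrow> nat \<Rightarrow> bool" where
  "stage_witness a e n w t \<longleftrightarrow> witness (re_stage {} a w) (re_stage {} a t) e n w"

lemma dec_true_witness:
  assumes "computable_in A e" "computable_in A n" "computable_in A w"
  shows "decidable_in A (\<lambda>x. true_witness A a (e x) (n x) (w x))"
  unfolding true_witness_def
  by (intro computability dec_witness dec_re_stage_empty dec_oracle assms assms[THEN computable_in_comp])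

lemma dec_stage_witness:
  assumes "computable_in Z e" "computable_in Z n" "computable_in Z w" "computable_in Z t"
  shows "decidable_in Z (\<lambda>x. stage_witness a (e x) (n x) (w x) (t x))"
  unfolding stage_witness_def
  by (intro computability dec_witness dec_re_stage_empty assms assms[THEN computable_in_comp])

lemma stage_witness_antimono: "s \<le> t \<Longrightarrow> stage_witness a e n w t \<Longrightarrow> stage_witness a e n w s"
  unfolding stage_witness_def witness_def queries_ok_def using re_stage_mono[of s t "{}" a] by blast

lemma true_witness_iff: "enumerates A a \<Longrightarrow> true_witness A a e n w \<longleftrightarrow> (\<forall>t. stage_witness a e n w t)"
  unfolding stage_witness_def witness_def queries_ok_def true_witness_def using enumerates_UN[of A a] by fastforce

lemma true_witness_sound:
  assumes "enumerates A a" "true_witness A a e n w" "l \<le> n * n" "m < 2 ^ l"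
  shows "\<exists>k\<le>l + ext_of w. run A (program_of e) (string_code (bits k (m + 2 ^ l * ext_of w))) \<noteq> None"
proof -
  have "re_stage {} a w \<subseteq> A" using enumerates_UN[OF assms(1)] by blast
  then have q: "closed_trace (set_decode (trace_of w))" "queries_ok A A (set_decode (trace_of w))"
    using assms(2) unfolding true_witness_def witness_def queries_ok_def by auto
  obtain k y where k: "k \<le> l + ext_of w"
    "triple e (string_code (bits k (m + 2 ^ l * ext_of w))) y \<in> set_decode (trace_of w)"
    using assms(2-4) unfolding true_witness_def witness_def covers_def by blast
  from trace_sound[OF q k(2)] k(1) show ?thesis by auto
qed

text \<open>
  Collect the traces of the computations for all finitely many strings to be
  covered, and pad the witness beyond the stage at which their positive queries are enumerated.
\<close>

lemma true_witness_exists: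
  assumes "enumerates A a" "dense_strings W"
    and W: "\<And>\<sigma>. \<sigma> \<in> W \<longleftrightarrow> run A (program_of e) (string_code \<sigma>) \<noteq> None"
  shows "\<exists>w. true_witness A a e n w"
proof -
  obtain u where u: "\<And>l m. l \<le> n * n \<Longrightarrow> m < 2 ^ l \<Longrightarrow> \<exists>k\<le>l + u. bits k (m + 2 ^ l * u) \<in> W"
    using uniform_extension_bits[OF assms(2)] by metis
  define I where "I = {(l, m, k). l \<le> n * n \<and> m < 2 ^ l \<and> k \<le> l + u \<and> bits k (m + 2 ^ l * u) \<in> W}"
  define x where "x = (\<lambda>(l, m, k). string_code (bits k (m + 2 ^ l * u)))"
  have "I \<subseteq> {..n * n} \<times> {..<2 ^ (n * n)} \<times> {..n * n + u}"
  proof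
    fix i assume "i \<in> I"
    moreover obtain l m k where "i = (l, m, k)" by (cases i) auto
    moreover have "(2::nat) ^ l \<le> 2 ^ (n * n)" if "l \<le> n * n" by (rule power_increasing) (use that in auto)
    ultimately show "i \<in> {..n * n} \<times> {..<2 ^ (n * n)} \<times> {..n * n + u}" unfolding I_def
      by (auto intro: less_le_trans)
  qed
  then have "finite I" by (rule finite_subset) simp
  moreover have "\<exists>L. halts A A e (x i) L" if "i \<in> I" for i
    using that W unfolding I_def x_def halts_iff_run by auto
  ultimately obtain L where L: "closed_trace (set_decode L)" "queries_ok A A (set_decode L)"
    "\<And>i. i \<in> I \<Longrightarrow> \<exists>y\<le>L. triple e (x i) y \<in> set_decode L"
    using closed_queries_join by blast
  have "finite {q. triple 4 q 1 \<in> set_decode L}"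
    by (rule finite_subset[of _ "{..L}"]) (auto dest: triple_le)
  moreover have "{q. triple 4 q 1 \<in> set_decode L} \<subseteq> (\<Union>t. re_stage {} a t)"
    using L(2) enumerates_UN[OF assms(1)] unfolding queries_ok_def by blast
  ultimately obtain s where s: "{q. triple 4 q 1 \<in> set_decode L} \<subseteq> re_stage {} a s"
  proof (atomize_elim, induction rule: finite_induct)
    case (insert q S)
    then obtain s t where "S \<subseteq> re_stage {} a s" "q \<in> re_stage {} a t" by auto
    then have "insert q S \<subseteq> re_stage {} a (max s t)"
      using re_stage_mono[of s "max s t"] re_stage_mono[of t "max s t"] by fastforce
    then show ?case by blast
  qed auto
  define w where "w = pr s (pr u L)"
  have w: "ext_of w = u" "trace_of w = L" "s \<le> w"
    unfolding w_def ext_of_def trace_of_def by (simp_all add: le_prod_encode_1)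
  have "queries_ok (re_stage {} a w) A (set_decode L)"
    using L(2) s re_stage_mono[OF w(3)] unfolding queries_ok_def by blast
  moreover have "covers e n w" unfolding covers_def w
  proof (intro allI impI)
    fix l m :: nat assume lm: "l \<le> n * n" "m < 2 ^ l"
    then obtain k where k: "k \<le> l + u" "bits k (m + 2 ^ l * u) \<in> W" using u by blast
    then have "(l, m, k) \<in> I" using lm unfolding I_def by blast
    from L(3)[OF this] k(1) show "\<exists>k\<le>l + u. \<exists>y\<le>L. triple e (string_code (bits k (m + 2 ^ l * u))) y \<in> set_decode L"
      unfolding x_def by auto
  qed
  ultimately have "true_witness A a e n w" unfolding true_witness_def witness_def w using L(1) by blast
  then show ?thesis by blast
qed

text \<open>
  A value above \<open>t\<close> means that no witness has been found by stage \<open>t\<close>.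
\<close>

definition first_witness :: "nat \<Rightarrow> nat \<Rightarrow> nat \<Rightarrow> nat \<Rightarrow> nat" where
  "first_witness a e n t = (LEAST w. stage_witness a e n w t \<or> t < w)"

lemma comp_first_witness:
  assumes "computable_in Z e" "computable_in Z n" "computable_in Z t"
  shows "computable_in Z (\<lambda>x. first_witness a (e x) (n x) (t x))"
  unfolding first_witness_def
proof (rule comp_Least)
  show "decidable_in Z (\<lambda>y. stage_witness a (e (pfst y)) (n (pfst y)) (psnd y) (t (pfst y)) \<or> t (pfst y) < psnd y)"
    by (intro computability dec_stage_witness assms assms[THEN computable_in_comp])
qed (meson lessI)

lemma first_witness_valid: "first_witness a e n t \<le> t \<Longrightarrow> stage_witness a e n (first_witness a e n t) t"
  using LeastI[of "\<lambda>w. stage_witness a e n w t \<or> t < w" "Suc t"] unfolding first_witness_def by auto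

lemma first_witness_le: "stage_witness a e n w t \<Longrightarrow> first_witness a e n t \<le> w"
  unfolding first_witness_def by (rule Least_le) simp

lemma first_witness_mono: 
  assumes "s \<le> t" shows "first_witness a e n s \<le> first_witness a e n t"
proof (cases "first_witness a e n t \<le> t")
  case True
  then have "stage_witness a e n (first_witness a e n t) s" using first_witness_valid stage_witness_antimono[OF assms] by blast
  then show ?thesis by (rule first_witness_le)
next
  case False
  have "first_witness a e n s \<le> Suc s" unfolding first_witness_def by (rule Least_le) simp
  then show ?thesis using False assms by simp
qed

text \<open>
  Candidates are only discarded and never return, so the least one moves up and stays
  put once it is correct.
\<close>

lemma first_witness_stable:
  assumes "enumerates A a" "true_witness A a e n (first_witness a e n s)" "s \<le> t"
  shows "first_witness a e n t = first_witness a e n s"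
  using first_witness_mono[OF assms(3)] first_witness_le assms(1,2) true_witness_iff by (meson le_antisym)

lemma first_witness_eventually_true:
  assumes "enumerates A a" "true_witness A a e n w"
  shows "\<forall>\<^sub>F t in sequentially. first_witness a e n t \<le> t \<and> true_witness A a e n (first_witness a e n t)"
proof -
  define v where "v = (LEAST w. true_witness A a e n w)"
  have v: "true_witness A a e n v" unfolding v_def using assms(2) by (rule LeastI)
  have "\<forall>\<^sub>F t in sequentially. \<forall>u\<in>{..<v}. \<not> stage_witness a e n u t"
  proof (intro eventually_ball_finite ballI)
    fix u assume "u \<in> {..<v}"
    then have "\<not> true_witness A a e n u" using not_less_Least unfolding v_def by blast
    then obtain t where "\<not> stage_witness a e n u t" using true_witness_iff[OF assms(1)] by blast
    then show "\<forall>\<^sub>F t in sequentially. \<not> stage_witness a e n u t"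
      unfolding eventually_sequentially using stage_witness_antimono by blast
  qed simp
  moreover have "\<forall>\<^sub>F t in sequentially. v \<le> t" by (rule eventually_ge_at_top)
  ultimately show ?thesis
  proof eventually_elim
    case (elim t)
    have "first_witness a e n t \<le> v" using first_witness_le v true_witness_iff[OF assms(1)] by blast
    moreover from this have "stage_witness a e n (first_witness a e n t) t" using first_witness_valid elim by force
    ultimately have "first_witness a e n t = v" using elim by force
    then show ?case using v elim by simp
  qed
qed

section \<open>Attempts and their releases\<close>

text \<open>
  A process that is free (0) or waits on the attempt \<open>n\<close> (\<open>Suc n\<close>). A free process enters
  the attempt of the current stage if \<open>E\<close> permits, and leaves it at the first later stage at which
  \<open>R\<close> declares it ready. Strategies and sequences \<open>X\<close> both behave in this way, with different \<open>E\<close>.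
\<close>

primrec pending :: "(nat \<Rightarrow> nat \<Rightarrow> bool) \<Rightarrow> (nat \<Rightarrow> bool) \<Rightarrow> nat \<Rightarrow> nat" where
  "pending R E 0 = 0"
| "pending R E (Suc s) =
     (if pending R E s = 0 then (if E s then Suc s else 0)
      else if R (pending R E s - 1) s then 0 else pending R E s)"

lemma pending_Suc_iff:
  "pending R E t = Suc n \<longleftrightarrow> n < t \<and> E n \<and> pending R E n = 0 \<and> (\<forall>s. n < s \<and> s < t \<longrightarrow> \<not> R n s)"
proof (induction t)
  case (Suc t)
  show ?case
  proof (cases "pending R E t")
    case 0
    have "\<not> (n < t \<and> E n \<and> pending R E n = 0 \<and> (\<forall>s. n < s \<and> s < t \<longrightarrow> \<not> R n s))"
      using Suc 0 by simp
    then have "(n < Suc t \<and> E n \<and> pending R E n = 0 \<and> (\<forall>s. n < s \<and> s < Suc t \<longrightarrow> \<not> R n s)) \<longleftrightarrow> n = t \<and> E t"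
      using 0 by (auto simp: less_Suc_eq)
    then show ?thesis using 0 by auto
  next
    case (Suc k)
    then show ?thesis using Suc.IH by (auto simp: less_Suc_eq)
  qed
qed simp

lemma pending_leaves:
  assumes "pending R E s = Suc n" "\<exists>t>n. R n t"
  obtains t where "s \<le> t" "R n t" "pending R E t = Suc n" "pending R E (Suc t) = 0"
    "t = (LEAST t. n < t \<and> R n t)"
proof -
  define t where "t = (LEAST t. n < t \<and> R n t)"
  have t: "n < t \<and> R n t" unfolding t_def using assms(2) by (rule LeastI_ex[of "\<lambda>t. n < t \<and> R n t"])
  have min: "\<not> (n < u \<and> R n u)" if "u < t" for u
    using that unfolding t_def by (rule not_less_Least)
  have s: "n < s" "E n" "pending R E n = 0" "\<forall>u. n < u \<and> u < s \<longrightarrow> \<not> R n u"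
    using assms(1) unfolding pending_Suc_iff by auto
  have "s \<le> t" using s(4) t by (meson not_le)
  moreover have tr: "pending R E t = Suc n" unfolding pending_Suc_iff using s t min by blast
  moreover have "pending R E (Suc t) = 0" using t tr by simp
  ultimately show ?thesis using that t t_def by blast
qed

lemma pending_next_entry:
  assumes "pending R E t = 0" "E s" "t \<le> s"
  obtains u where "t \<le> u" "E u" "pending R E u = 0"
proof -
  define u where "u = (LEAST u. t \<le> u \<and> E u)"
  have u: "t \<le> u \<and> E u" unfolding u_def by (rule LeastI[of "\<lambda>u. t \<le> u \<and> E u" s]) (use assms in simp)
  have min: "\<not> (t \<le> k \<and> E k)" if "k < u" for k
    using that unfolding u_def by (rule not_less_Least)
  have "pending R E u = 0"
  proof (rule ccontr)
    assume "pending R E u \<noteq> 0"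
    then obtain n where n: "pending R E u = Suc n" by (meson not0_implies_Suc)
    then have n': "n < u" "E n" "pending R E n = 0" "\<forall>k. n < k \<and> k < u \<longrightarrow> \<not> R n k"
      unfolding pending_Suc_iff by auto
    then have "n < t" using min[of n] by auto
    then have "pending R E t = Suc n" using n' u unfolding pending_Suc_iff by auto
    then show False using assms(1) by simp
  qed
  then show ?thesis using that u by blast
qed

lemma comp_pending:
  assumes R: "decidable_in Z (\<lambda>y. R (pfst y) (pfst (psnd y)) (psnd (psnd y)))"
    and E: "decidable_in Z (\<lambda>y. E (pfst y) (psnd y))" and f: "computable_in Z f"
  shows "computable_in Z (\<lambda>x. pending (R x) (E x) (f x))"
proof -
  have eq: "pending (R x) (E x) n = rec_nat 0 (\<lambda>s v. if v = 0 then (if E x s then Suc s else 0)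
      else if R x (v - 1) s then 0 else v) n" for x n
    by (induction n) auto
  have E': "decidable_in Z (\<lambda>x. E (h x) (k x))" if "computable_in Z h" "computable_in Z k" for h k
    by (rule decidable_in_comp2[OF E that])
  have R': "decidable_in Z (\<lambda>x. R (h x) (k x) (l x))"
    if "computable_in Z h" "computable_in Z k" "computable_in Z l" for h k l
    by (rule decidable_in_comp3[OF R that])
  show ?thesis unfolding eq by (intro computability E' R' f)
qed

text \<open>
  The first component of a stage \<open>n\<close> is the strategy that may open an attempt at \<open>n\<close>; so every strategy
  gets infinitely many stages. A strategy is a pair of the index of the set to be
  entered and the threshold from which on it trusts the limit approximation.
\<close>

definition requirement :: "nat \<Rightarrow> nat" where "requirement n = pfst (pfst n)"
definition threshold :: "nat \<Rightarrow> nat" where "threshold n = psnd (pfst n)"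

lemma comp_requirement [computability]: "computable_in Z f \<Longrightarrow> computable_in Z (\<lambda>x. requirement (f x))"
  unfolding requirement_def by (intro computability)
lemma comp_threshold [computability]: "computable_in Z f \<Longrightarrow> computable_in Z (\<lambda>x. threshold (f x))"
  unfolding threshold_def by (intro computability)

locale low2_re =
  fixes A :: "nat set" and a :: nat and r :: "nat \<Rightarrow> nat"
  assumes enum: "enumerates A a"
    and r_comp: "computable_in {} r"
    and r_lim: "\<And>z. \<forall>\<^sub>F s in sequentially. \<forall>\<^sub>F t in sequentially.
                  r (pr (pr z s) t) = of_bool (z \<in> jump (jump A))"
begin

text \<open>
  The attempt has a witness, and from the threshold up to \<open>n\<close> the approximation says that
  \<open>smn x (pr x e)\<close> is not in the double jump of \<open>A\<close>. For the right choice of \<open>x\<close> this means that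
  strategies for \<open>e\<close> keep finding correct witnesses. The range grows with \<open>n\<close>, so if the approximation
  converges to the opposite answer, some \<open>s\<close> in the range of all late attempts blocks them.
\<close>

definition ready :: "nat \<Rightarrow> nat \<Rightarrow> nat \<Rightarrow> bool" where
  "ready x n t \<longleftrightarrow> first_witness a (requirement n) n t \<le> t \<and>
     (\<forall>s\<le>n. threshold n \<le> s \<longrightarrow> r (pr (pr (smn x (pr x (requirement n))) s) t) = 0)"

definition wait :: "nat \<Rightarrow> nat \<Rightarrow> nat \<Rightarrow> nat" where
  "wait x q = pending (ready x) (\<lambda>s. pfst s = q)"

definition opened :: "nat \<Rightarrow> nat \<Rightarrow> bool" where
  "opened x n \<longleftrightarrow> wait x (pfst n) n = 0"

definition release :: "nat \<Rightarrow> nat \<Rightarrow> nat" where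
  "release x n = (LEAST t. n < t \<and> ready x n t)"

text \<open>
  The attempt must still be pending. Correct witnesses that appear only after a release
  are of no use to the sequences that were released.
\<close>

definition holds_true :: "nat \<Rightarrow> nat \<Rightarrow> nat \<Rightarrow> nat \<Rightarrow> bool" where
  "holds_true x e c t \<longleftrightarrow> wait x (pr e c) t \<noteq> 0 \<and>
     first_witness a e (wait x (pr e c) t - 1) t \<le> t \<and>
     true_witness A a e (wait x (pr e c) t - 1) (first_witness a e (wait x (pr e c) t - 1) t)"

lemma comp_r: "computable_in Z f \<Longrightarrow> computable_in Z (\<lambda>x. r (f x))"
  by (rule computable_in_comp[OF computable_in_mono[OF r_comp]])

lemma dec_ready:
  assumes "computable_in Z x" "computable_in Z n" "computable_in Z t"
  shows "decidable_in Z (\<lambda>y. ready (x y) (n y) (t y))"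
  unfolding ready_def
  by (intro computability comp_first_witness comp_r assms assms[THEN computable_in_comp])

lemma comp_wait:
  assumes "computable_in Z x" "computable_in Z q" "computable_in Z t"
  shows "computable_in Z (\<lambda>y. wait (x y) (q y) (t y))"
  unfolding wait_def
  by (intro comp_pending dec_ready computability assms assms[THEN computable_in_comp])

lemma dec_opened:
  assumes "computable_in Z x" "computable_in Z n"
  shows "decidable_in Z (\<lambda>y. opened (x y) (n y))"
  unfolding opened_def by (intro comp_wait computability assms)

lemma dec_holds_true:
  assumes "computable_in A x" "computable_in A e" "computable_in A c" "computable_in A t"
  shows "decidable_in A (\<lambda>y. holds_true (x y) (e y) (c y) (t y))"
  unfolding holds_true_def
  by (intro computability comp_wait comp_first_witness dec_true_witness assms)

text \<open>
  The parameter \<open>x\<close> of the construction denotes the \<open>\<Sigma>\<^sub>2\<close> statement that some strategy for \<open>e\<close> eventually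
  stops holding correct witnesses in this same construction.
\<close>

definition self_referential :: "nat \<Rightarrow> bool" where
  "self_referential x \<longleftrightarrow> (\<forall>e. smn x (pr x e) \<in> jump (jump A) \<longleftrightarrow> \<not> (\<forall>c i. \<exists>t\<ge>i. holds_true x e c t))"

lemma self_referential_exists: "\<exists>x. self_referential x"
proof -
  \<comment> \<open>the universally quantified pair \<open>(c, i)\<close> is coded by the single number \<open>v\<close> of \<open>Pi2_fixed_point\<close>\<close>
  define D where "D y \<longleftrightarrow> psnd (psnd (pfst y)) \<le> psnd y \<and>
    holds_true (pfst (pfst (pfst y))) (psnd (pfst (pfst y))) (pfst (psnd (pfst y))) (psnd y)" for y
  have "decidable_in A D" unfolding D_def[abs_def] by (intro computability dec_holds_true)
  then obtain x where x: "\<And>e. smn x (pr x e) \<in> jump (jump A) \<longleftrightarrow> \<not> (\<forall>v. \<exists>t. D (pr (pr (pr x e) v) t))"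
    using Pi2_fixed_point by blast
  have "(\<forall>v. \<exists>t. D (pr (pr (pr x e) v) t)) \<longleftrightarrow> (\<forall>c i. \<exists>t\<ge>i. holds_true x e c t)" for e
    unfolding D_def by (simp, metis fst_conv snd_conv prod_encode_inverse)
  then have "self_referential x" using x unfolding self_referential_def by blast
  then show ?thesis by blast
qed

lemma wait_Suc_iff:
  "wait x q t = Suc n \<longleftrightarrow> pfst n = q \<and> opened x n \<and> n < t \<and> (\<forall>s. n < s \<and> s < t \<longrightarrow> \<not> ready x n s)"
  unfolding wait_def opened_def pending_Suc_iff by auto

lemma opened_unbounded:
  assumes "\<And>n. opened x n \<Longrightarrow> pfst n = q \<Longrightarrow> \<exists>t>n. ready x n t"
  shows "\<exists>n\<ge>N. opened x n \<and> pfst n = q"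
proof -
  have step: "\<exists>n\<ge>k. opened x n \<and> pfst n = q" if k: "wait x q k = 0" for k
  proof -
    have "pfst (pr q k) = q" "k \<le> pr q k" by (simp_all add: le_prod_encode_2)
    from pending_next_entry[of "ready x" "\<lambda>s. pfst s = q" k, OF k[unfolded wait_def] this]
    show ?thesis unfolding opened_def wait_def by metis
  qed
  show ?thesis
  proof (cases "wait x q N")
    case (Suc n)
    then have "\<exists>t>n. ready x n t" using assms wait_Suc_iff by blast
    from pending_leaves[OF Suc[unfolded wait_def] this] obtain t
      where "N \<le> t" "wait x q (Suc t) = 0" unfolding wait_def by metis
    with step[of "Suc t"] show ?thesis by (meson Suc_leD order_trans)
  qed (rule step)
qed

text \<open>
  If some strategy for \<open>e\<close> stopped holding correct witnesses, the approximation would converge to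
  blocking. The strategy would then be left with an attempt that is pending forever; as \<open>W\<close> is dense, the
  first witness of that attempt is eventually correct, a contradiction.
\<close>

lemma dense_imp_holds_true:
  assumes x: "self_referential x"
    and dense: "dense_strings W" "\<And>\<sigma>. \<sigma> \<in> W \<longleftrightarrow> run A (program_of e) (string_code \<sigma>) \<noteq> None"
  shows "\<forall>c i. \<exists>t\<ge>i. holds_true x e c t"
proof (rule ccontr)
  assume neg: "\<not> ?thesis"
  then obtain c i where ci: "\<And>t. i \<le> t \<Longrightarrow> \<not> holds_true x e c t" by blast
  define z where "z = smn x (pr x e)"
  have "z \<in> jump (jump A)" using x neg unfolding self_referential_def z_def by blast
  then have "\<forall>\<^sub>F s in sequentially. \<forall>\<^sub>F t in sequentially. r (pr (pr z s) t) = 1"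
    using r_lim[of z] by simp
  then obtain s0 where s0: "c \<le> s0" "\<forall>\<^sub>F t in sequentially. r (pr (pr z s0) t) = 1"
    unfolding eventually_sequentially by (meson nat_le_linear)
  then obtain t0 where t0: "\<And>t. t0 \<le> t \<Longrightarrow> r (pr (pr z s0) t) = 1"
    unfolding eventually_sequentially by blast
  have "\<exists>n. opened x n \<and> pfst n = pr e c \<and> (\<forall>t>n. \<not> ready x n t)"
  proof (rule ccontr)
    assume "\<not> ?thesis"
    then have all: "\<And>n. opened x n \<Longrightarrow> pfst n = pr e c \<Longrightarrow> \<exists>t>n. ready x n t" by blast
    \<comment> \<open>an attempt opened this late has \<open>s0\<close> in its guarded range and only sees final values of \<open>r\<close>\<close>
    obtain n where n: "n \<ge> max s0 t0" "opened x n" "pfst n = pr e c"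
      using opened_unbounded[OF all] by blast
    obtain t where t: "n < t" "ready x n t" using all n by blast
    have "r (pr (pr z s0) t) = 0"
      using t(2) n s0(1) unfolding ready_def requirement_def threshold_def z_def by simp
    then show False using t0[of t] t(1) n(1) by simp
  qed
  then obtain n where n: "opened x n" "pfst n = pr e c" "\<And>t. n < t \<Longrightarrow> \<not> ready x n t" by blast
  obtain w where "true_witness A a e n w" using true_witness_exists[OF enum dense] by blast
  from first_witness_eventually_true[OF enum this] obtain t1
    where t1: "\<And>t. t1 \<le> t \<Longrightarrow> first_witness a e n t \<le> t \<and> true_witness A a e n (first_witness a e n t)"
    unfolding eventually_sequentially by blast
  define t where "t = max (max i t1) (Suc n)"
  have "wait x (pr e c) t = Suc n" unfolding wait_Suc_iff using n t_def by auto
  then have "holds_true x e c t" unfolding holds_true_def using t1[of t] t_def by simp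
  then show False using ci t_def by simp
qed

definition success :: "nat \<Rightarrow> nat \<Rightarrow> nat \<Rightarrow> bool" where
  "success x e n \<longleftrightarrow> opened x n \<and> (\<exists>t>n. ready x n t) \<and> requirement n = e \<and>
     true_witness A a e n (first_witness a e n (release x n))"

text \<open>
  By the previous lemma the approximation converges to the favourable answer for all \<open>s\<close> above some
  \<open>d\<close>. With this \<open>d\<close> as threshold every attempt is released, so correct witnesses held at
  arbitrarily late stages belong to infinitely many attempts; and a correct witness is kept
  until the release.
\<close>

lemma infinitely_many_successes:
  assumes x: "self_referential x"
    and dense: "dense_strings W" "\<And>\<sigma>. \<sigma> \<in> W \<longleftrightarrow> run A (program_of e) (string_code \<sigma>) \<noteq> None"
  shows "\<exists>q. \<forall>N. \<exists>n\<ge>N. pfst n = q \<and> success x e n"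
proof -
  have holds_true: "\<exists>t\<ge>i. holds_true x e c t" for c i using dense_imp_holds_true[OF assms] by blast
  define z where "z = smn x (pr x e)"
  have "z \<notin> jump (jump A)" using x holds_true unfolding self_referential_def z_def by blast
  then have "\<forall>\<^sub>F s in sequentially. \<forall>\<^sub>F t in sequentially. r (pr (pr z s) t) = 0"
    using r_lim[of z] by simp
  then obtain d where d: "\<And>s. d \<le> s \<Longrightarrow> \<forall>\<^sub>F t in sequentially. r (pr (pr z s) t) = 0"
    unfolding eventually_sequentially[of "\<lambda>s. \<forall>\<^sub>F t in sequentially. r (pr (pr z s) t) = 0"] by blast
  have ready: "\<forall>\<^sub>F t in sequentially. n < t \<and> ready x n t" if n: "pfst n = pr e d" for n
  proof -
    obtain w where "true_witness A a e n w" using true_witness_exists[OF enum dense] by blast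
    from first_witness_eventually_true[OF enum this] have "\<forall>\<^sub>F t in sequentially. first_witness a e n t \<le> t"
      by (rule eventually_mono) simp
    moreover have "\<forall>\<^sub>F t in sequentially. \<forall>s\<in>{d..n}. r (pr (pr z s) t) = 0"
      using d by (intro eventually_ball_finite) auto
    moreover have "\<forall>\<^sub>F t in sequentially. n < t" by (rule eventually_gt_at_top)
    ultimately show ?thesis
      by eventually_elim (use n in \<open>auto simp: ready_def requirement_def threshold_def z_def\<close>)
  qed
  have "\<exists>n\<ge>N. pfst n = pr e d \<and> success x e n" for N
  proof -
    have "\<forall>\<^sub>F t in sequentially. \<forall>n\<in>{n. n < N \<and> pfst n = pr e d}. n < t \<and> ready x n t"
      using ready by (intro eventually_ball_finite) auto
    then obtain T where T: "\<And>n. n < N \<Longrightarrow> pfst n = pr e d \<Longrightarrow> n < T \<and> ready x n T"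
      unfolding eventually_sequentially by blast
    \<comment> \<open>by stage \<open>T\<close> all attempts of this strategy opened before \<open>N\<close> are released, so a pending one is new\<close>
    obtain t where t: "Suc T \<le> t" "holds_true x e d t" using holds_true by blast
    then obtain n where n: "wait x (pr e d) t = Suc n" unfolding holds_true_def by (meson not0_implies_Suc)
    then have n': "pfst n = pr e d" "opened x n" "\<forall>s. n < s \<and> s < t \<longrightarrow> \<not> ready x n s"
      unfolding wait_Suc_iff by auto
    have "N \<le> n" using n'(1,3) T[of n] t(1) by (metis Suc_le_lessD not_le)
    moreover have "success x e n"
    proof -
      have ex: "\<exists>u>n. ready x n u"
        using ready[OF n'(1)] unfolding eventually_sequentially by blast
      obtain u where u: "t \<le> u" "u = release x n"
        using pending_leaves[OF n[unfolded wait_def] ex] unfolding release_def by metis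
      have "first_witness a e n u = first_witness a e n t"
        using t(2) n u(1) by (intro first_witness_stable[OF enum]) (auto simp: holds_true_def)
      then have "true_witness A a e n (first_witness a e n (release x n))"
        using t(2) n u(2) unfolding holds_true_def by simp
      then show ?thesis using ex n' unfolding success_def requirement_def by simp
    qed
    ultimately show ?thesis using n'(1) by blast
  qed
  then show ?thesis by blast
qed

end

section \<open>The generic set computed by a random sequence\<close>

primrec limit_length :: "(nat \<Rightarrow> nat) \<Rightarrow> nat \<Rightarrow> nat" where
  "limit_length k 0 = 0"
| "limit_length k (Suc s) = limit_length k s + k s"

primrec limit_value :: "(nat \<Rightarrow> nat) \<Rightarrow> (nat \<Rightarrow> nat) \<Rightarrow> nat \<Rightarrow> nat" where
  "limit_value k u 0 = 0"
| "limit_value k u (Suc s) = limit_value k u s + 2 ^ limit_length k s * u s"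

text \<open>
  The set whose characteristic sequence is obtained by appending, for \<open>s = 0, 1, 2\<close> and so on, the
  chunk of \<open>k s\<close> bits given by the number \<open>u s\<close>. Bit \<open>i\<close> is final once the length exceeds \<open>i\<close>.
\<close>

definition limit_set :: "(nat \<Rightarrow> nat) \<Rightarrow> (nat \<Rightarrow> nat) \<Rightarrow> nat set" where
  "limit_set k u = {i. bit (limit_value k u (LEAST s. i < limit_length k s)) i}"

lemma limit_length_mono: "s \<le> t \<Longrightarrow> limit_length k s \<le> limit_length k t"
  by (induction t) (auto simp: le_Suc_eq)

lemma limit_value_less:
  assumes "\<And>s. u s < 2 ^ k s"
  shows "limit_value k u s < 2 ^ limit_length k s"
proof (induction s)
  case (Suc s)
  have "limit_value k u s + 2 ^ limit_length k s * u s < 2 ^ limit_length k s + 2 ^ limit_length k s * u s" using Suc by simp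
  also have "\<dots> = 2 ^ limit_length k s * Suc (u s)" by simp
  also have "\<dots> \<le> 2 ^ limit_length k s * 2 ^ k s" using assms[of s] by (intro mult_le_mono) auto
  finally show ?case by (simp add: power_add)
qed simp

lemma limit_value_stable:
  assumes "\<And>s. u s < 2 ^ k s" "s \<le> t" "i < limit_length k s"
  shows "bit (limit_value k u t) i = bit (limit_value k u s) i"
  using assms(2)
proof (induction t rule: dec_induct)
  case (step t)
  have "i < limit_length k t" using assms(3) limit_length_mono[OF step(1)] by (rule less_le_trans)
  then show ?case using step(3) bit_concat[OF limit_value_less[OF assms(1)]] by simp
qed simp

lemma initial_segment_limit_set:
  assumes "\<And>s. u s < 2 ^ k s" "j \<le> limit_length k s"
  shows "initial_segment (limit_set k u) j = bits j (limit_value k u s)"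
proof -
  have "i \<in> limit_set k u \<longleftrightarrow> bit (limit_value k u s) i" if "i < j" for i
  proof -
    define l where "l = (LEAST s. i < limit_length k s)"
    have "i < limit_length k s" using that assms(2) by simp
    then have "i < limit_length k l" "l \<le> s"
      unfolding l_def by (auto intro: LeastI[of "\<lambda>s. i < limit_length k s"] Least_le[of "\<lambda>s. i < limit_length k s"])
    then show ?thesis using limit_value_stable[of u k l s i, OF assms(1)] unfolding limit_set_def l_def by simp
  qed
  then show ?thesis unfolding initial_segment_def bits_def by simp
qed

lemma comp_limit_length:
  assumes "computable_in Z k" "computable_in Z f"
  shows "computable_in Z (\<lambda>x. limit_length k (f x))"
proof -
  have "limit_length k n = rec_nat 0 (\<lambda>s v. v + k s) n" for n by (induction n) auto
  moreover have "computable_in Z (\<lambda>x. rec_nat 0 (\<lambda>s v. v + k s) (f x))"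
    by (intro computability assms assms[THEN computable_in_comp])
  ultimately show ?thesis by simp
qed

lemma comp_limit_value:
  assumes "computable_in Z k" "computable_in Z u" "computable_in Z f"
  shows "computable_in Z (\<lambda>x. limit_value k u (f x))"
proof -
  have "limit_value k u n = rec_nat 0 (\<lambda>s v. v + 2 ^ limit_length k s * u s) n" for n by (induction n) auto
  moreover have "computable_in Z (\<lambda>x. rec_nat 0 (\<lambda>s v. v + 2 ^ limit_length k s * u s) (f x))"
    by (intro computability comp_limit_length assms assms[THEN computable_in_comp])
  ultimately show ?thesis by simp
qed

lemma limit_set_turing_le:
  assumes "computable_in Z k" "computable_in Z u" "\<And>i. \<exists>s. i < limit_length k s"
  shows "limit_set k u \<le>\<^sub>T Z"
proof -
  have "computable_in Z (\<lambda>i. LEAST s. i < limit_length k s)"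
    by (rule comp_Least[OF _ assms(3)]) (intro computability comp_limit_length assms(1))
  then have "decidable_in Z (\<lambda>i. i \<in> limit_set k u)"
    unfolding limit_set_def mem_Collect_eq by (intro computability comp_limit_value assms(1,2))
  then show ?thesis unfolding decidable_in_def computable_in_def turing_le_def .
qed

text \<open>
  The coin test of the attempt \<open>n\<close>. It has probability \<open>2^-(q + c)\<close> for the strategy \<open>q\<close> of \<open>n\<close>, and
  different attempts use different coins.
\<close>

definition portion :: "nat \<Rightarrow> nat \<Rightarrow> (nat \<Rightarrow> bool) \<Rightarrow> bool" where
  "portion c n X \<longleftrightarrow> (\<forall>i<pfst n + c. X (pr n i))"

context low2_re begin

definition busy :: "nat \<Rightarrow> nat \<Rightarrow> (nat \<Rightarrow> bool) \<Rightarrow> nat \<Rightarrow> nat" where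
  "busy x c X = pending (ready x) (\<lambda>s. opened x s \<and> portion c s X)"

definition releases :: "nat \<Rightarrow> nat \<Rightarrow> (nat \<Rightarrow> bool) \<Rightarrow> nat \<Rightarrow> bool" where
  "releases x c X s \<longleftrightarrow> busy x c X s \<noteq> 0 \<and> ready x (busy x c X s - 1) s"

definition chunk :: "nat \<Rightarrow> nat \<Rightarrow> (nat \<Rightarrow> bool) \<Rightarrow> nat \<Rightarrow> nat" where
  "chunk x c X s = (if releases x c X s
     then ext_of (first_witness a (requirement (busy x c X s - 1)) (busy x c X s - 1) s) else 0)"

text \<open>
  A chunk \<open>u\<close> is appended with length \<open>u + 1\<close>, so that the set grows even if \<open>u\<close> is 0. A free stage
  without entry appends a single bit 0.
\<close>

definition growth :: "nat \<Rightarrow> nat \<Rightarrow> (nat \<Rightarrow> bool) \<Rightarrow> nat \<Rightarrow> nat" where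
  "growth x c X s = (if releases x c X s then Suc (chunk x c X s)
     else of_bool (busy x c X s = 0 \<and> \<not> (opened x s \<and> portion c s X)))"

definition generic_of :: "nat \<Rightarrow> nat \<Rightarrow> (nat \<Rightarrow> bool) \<Rightarrow> nat set" where
  "generic_of x c X = limit_set (growth x c X) (chunk x c X)"

text \<open>
  The coin test of an attempt that is never released is passed. Whether \<open>X\<close> is free when that attempt is
  opened is ignored, which makes the event a plain union of coin tests.
\<close>

definition stuck :: "nat \<Rightarrow> nat \<Rightarrow> (nat \<Rightarrow> bool) \<Rightarrow> bool" where
  "stuck x c X \<longleftrightarrow> (\<exists>n. opened x n \<and> portion c n X \<and> \<not> (\<exists>t>n. ready x n t))"

lemma dec_portion:
  assumes "computable_in (Collect X) f"
  shows "decidable_in (Collect X) (\<lambda>s. portion c (f s) X)"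
proof -
  have "decidable_in (Collect X) (\<lambda>s. \<forall>i<pfst (f s) + c. pr (f s) i \<in> Collect X)"
    by (intro computability dec_oracle assms computable_in_comp[OF assms])
  then show ?thesis unfolding portion_def by simp
qed

lemma comp_busy:
  "computable_in (Collect X) f \<Longrightarrow> computable_in (Collect X) (\<lambda>s. busy x c X (f s))"
  unfolding busy_def by (intro comp_pending dec_ready dec_opened dec_portion computability)

lemma dec_releases:
  "computable_in (Collect X) f \<Longrightarrow> decidable_in (Collect X) (\<lambda>s. releases x c X (f s))"
  unfolding releases_def by (intro computability comp_busy dec_ready)

lemma comp_chunk:
  "computable_in (Collect X) f \<Longrightarrow> computable_in (Collect X) (\<lambda>s. chunk x c X (f s))"
  unfolding chunk_def by (intro computability comp_busy comp_first_witness dec_releases)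

lemma comp_growth:
  "computable_in (Collect X) f \<Longrightarrow> computable_in (Collect X) (\<lambda>s. growth x c X (f s))"
  unfolding growth_def by (intro computability comp_busy comp_chunk dec_releases dec_opened dec_portion)

lemma chunk_less: "chunk x c X s < 2 ^ growth x c X s"
proof (cases "releases x c X s")
  case True
  then show ?thesis unfolding growth_def using less_exp[of "Suc (chunk x c X s)"] by simp
qed (simp add: chunk_def)

lemma limit_length_growth_le: "limit_length (growth x c X) s \<le> s * s"
proof (induction s)
  case (Suc s)
  have "chunk x c X s \<le> s"
    using ext_of_le order_trans unfolding chunk_def releases_def ready_def by auto
  then have "growth x c X s \<le> Suc s" unfolding growth_def by auto
  then show ?case using Suc by simp
qed simp

lemma growth_unbounded:
  assumes "\<not> stuck x c X"
  shows "\<exists>s. i < limit_length (growth x c X) s"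
proof -
  have next_growth: "\<exists>t\<ge>s. 0 < growth x c X t" for s
  proof -
    have leave: "\<exists>t\<ge>s'. 0 < growth x c X t" if s': "busy x c X s' = Suc n" for s' n
    proof -
      have "opened x n" "portion c n X" using s' unfolding busy_def pending_Suc_iff by auto
      then have "\<exists>t>n. ready x n t" using assms unfolding stuck_def by blast
      from pending_leaves[OF s'[unfolded busy_def] this] obtain t
        where "s' \<le> t" "ready x n t" "busy x c X t = Suc n" unfolding busy_def by metis
      then show ?thesis unfolding growth_def releases_def by (intro exI[of _ t]) simp
    qed
    show ?thesis
    proof (cases "busy x c X s")
      case 0
      show ?thesis
      proof (cases "opened x s \<and> portion c s X")
        case True
        then have "busy x c X (Suc s) = Suc s" using 0 unfolding busy_def by simp
        from leave[OF this] show ?thesis by (meson Suc_leD)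
      next
        case False
        then show ?thesis using 0 unfolding growth_def by (intro exI[of _ s]) auto
      qed
    next
      case (Suc n)
      then show ?thesis by (rule leave)
    qed
  qed
  show ?thesis
  proof (induction i)
    case 0
    obtain t where "0 < growth x c X t" using next_growth by blast
    then have "0 < limit_length (growth x c X) (Suc t)" by simp
    then show ?case by blast
  next
    case (Suc i)
    then obtain s where s: "i < limit_length (growth x c X) s" by blast
    obtain t where t: "s \<le> t" "0 < growth x c X t" using next_growth by blast
    have "Suc i < limit_length (growth x c X) (Suc t)"
      using s t(2) limit_length_mono[OF t(1), of "growth x c X"] by simp
    then show ?case by blast
  qed
qed

lemma generic_of_turing_le: "\<not> stuck x c X \<Longrightarrow> generic_of x c X \<le>\<^sub>T Collect X"
  unfolding generic_of_def
  by (intro limit_set_turing_le growth_unbounded comp_growth[OF comp_id] comp_chunk[OF comp_id])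

text \<open>
  While \<open>X\<close> waits nothing is appended, so at the release the length is still at most \<open>n\<^sup>2\<close> and the
  correct witness applies.
\<close>

lemma served_meets_requirement:
  assumes succ: "success x e n" and port: "portion c n X" and free: "busy x c X n = 0"
  shows "\<exists>k. run A (program_of e) (string_code (initial_segment (generic_of x c X) k)) \<noteq> None"
proof -
  let ?k = "growth x c X" and ?u = "chunk x c X"
  have ex: "\<exists>t>n. ready x n t" and op: "opened x n" and e: "requirement n = e" using succ unfolding success_def by auto
  define t where "t = release x n"
  have start: "busy x c X (Suc n) = Suc n" using free op port unfolding busy_def by simp
  from pending_leaves[OF start[unfolded busy_def] ex]
  have t: "Suc n \<le> t" "ready x n t" "busy x c X t = Suc n"
    unfolding t_def release_def busy_def by metis+
  have wait: "busy x c X s = Suc n \<and> \<not> ready x n s" if "n < s" "s < t" for s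
    using t(3) that unfolding busy_def pending_Suc_iff by auto
  have same: "limit_length ?k s = limit_length ?k n" if "n \<le> s" "s \<le> t" for s
    using that
  proof (induction s rule: dec_induct)
    case (step s)
    have "?k s = 0"
    proof (cases "s = n")
      case True
      then show ?thesis using free op port unfolding growth_def releases_def by simp
    next
      case False
      then have "busy x c X s = Suc n \<and> \<not> ready x n s" using step by (intro wait) auto
      then show ?thesis unfolding growth_def releases_def by simp
    qed
    then show ?case using step by simp
  qed simp
  have "limit_length ?k t \<le> n * n" using same[OF _ order_refl] t(1) limit_length_growth_le[of x c X n] by simp
  moreover have "limit_value ?k ?u t < 2 ^ limit_length ?k t" by (rule limit_value_less[OF chunk_less])
  moreover have "true_witness A a e n (first_witness a e n t)" using succ unfolding success_def t_def by blast
  moreover have u: "?u t = ext_of (first_witness a e n t)" using t e unfolding chunk_def releases_def by simp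
  ultimately obtain j where j: "j \<le> limit_length ?k t + ?u t"
    "run A (program_of e) (string_code (bits j (limit_value ?k ?u t + 2 ^ limit_length ?k t * ?u t))) \<noteq> None"
    using true_witness_sound[OF enum] by metis
  have "?k t = Suc (?u t)" using t unfolding growth_def releases_def by simp
  then have "j \<le> limit_length ?k (Suc t)" using j(1) by simp
  from initial_segment_limit_set[OF chunk_less this] j(2) show ?thesis
    unfolding generic_of_def by (intro exI[of _ j]) simp
qed

text \<open>
  The premise asks that \<open>X\<close> takes part in one success for every \<open>e\<close> that has infinitely many; these
  include all indices of dense sets.
\<close>

lemma generic_of_weakly_generic:
  assumes "\<And>e. (\<exists>q. \<forall>N. \<exists>n\<ge>N. pfst n = q \<and> success x e n)
             \<Longrightarrow> \<exists>n. success x e n \<and> portion c n X \<and> busy x c X n = 0"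
    and x: "self_referential x"
  shows "weakly_1_generic A (generic_of x c X)"
  unfolding weakly_1_generic_def
proof (intro allI impI, elim conjE)
  fix W assume W: "dense_strings W" "re_strings_in A W"
  then obtain p where p: "string_code ` W = {n. run A p n \<noteq> None}"
    unfolding re_strings_in_def re_in_def by blast
  obtain e where e: "program_of e = p" using surj_program_of by (metis surjD)
  have mem: "\<sigma> \<in> W \<longleftrightarrow> run A (program_of e) (string_code \<sigma>) \<noteq> None" for \<sigma>
  proof -
    have "\<sigma> \<in> W \<longleftrightarrow> string_code \<sigma> \<in> string_code ` W" by (auto simp: string_code_inject)
    then show ?thesis unfolding p e by simp
  qed
  from infinitely_many_successes[OF x W(1) mem] obtain n
    where "success x e n" "portion c n X" "busy x c X n = 0" using assms(1) by blast
  from served_meets_requirement[OF this] show "\<exists>m. initial_segment (generic_of x c X) m \<in> W" unfolding mem .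
qed

end

section \<open>Almost every sequence takes part in a successful attempt\<close>

abbreviation coin :: "bool measure" where "coin \<equiv> measure_pmf (bernoulli_pmf (1/2))"

lemma space_cantor [simp]: "space cantor_measure = UNIV"
  unfolding cantor_measure_def by (simp add: space_PiM)

interpretation cantor: prob_space cantor_measure
  unfolding cantor_measure_def by (rule prob_space_PiM) (rule measure_pmf.prob_space_axioms)

interpretation coins: product_prob_space "\<lambda>_::nat. coin" UNIV
  by unfold_locales

lemma prob_cylinder:
  assumes "finite D"
  shows "cantor.prob {X. \<forall>i\<in>D. X i \<in> B i} = (\<Prod>i\<in>D. measure coin (B i))"
proof -
  have "emeasure cantor_measure {X \<in> space cantor_measure. \<forall>i\<in>D. X i \<in> B i} = (\<Prod>i\<in>D. emeasure coin (B i))"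
    unfolding cantor_measure_def by (rule coins.emeasure_PiM_Collect) (use assms in auto)
  also have "\<dots> = ennreal (\<Prod>i\<in>D. measure coin (B i))"
    by (simp add: measure_pmf.emeasure_eq_measure prod_ennreal)
  finally show ?thesis by (simp add: measure_def prod_nonneg)
qed

lemma prob_all_true: "finite D \<Longrightarrow> cantor.prob {X. \<forall>i\<in>D. X i} = (1/2) ^ card D"
  using prob_cylinder[of D "\<lambda>_. {True}"] by (simp add: measure_pmf_single)

lemma cantor_coordinate_measurable [measurable]: "(\<lambda>X. X i) \<in> measurable cantor_measure (count_space UNIV)"
proof -
  have "(\<lambda>X. X i) \<in> measurable cantor_measure coin"
    unfolding cantor_measure_def by (rule measurable_component_singleton) simp
  then show ?thesis by simp
qed

lemma indep_coordinates: "cantor.indep_vars (\<lambda>_. coin) (\<lambda>i X. X i) UNIV"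
proof -
  have rv: "(\<lambda>X. X i) \<in> measurable cantor_measure coin" for i
    unfolding cantor_measure_def by (rule measurable_component_singleton) simp
  have "distr cantor_measure coin (\<lambda>X. X i) = coin" for i
    unfolding cantor_measure_def by (rule distr_PiM_component) (auto intro: measure_pmf.prob_space_axioms)
  then show ?thesis using rv
    by (subst cantor.indep_vars_iff_distr_eq_PiM) (auto simp: cantor_measure_def[symmetric] restrict_UNIV)
qed

text \<open>
  The second Borel-Cantelli lemma in the form needed here, for events of probability bounded below
  that are determined by disjoint finite sets of coins.
\<close>

lemma AE_ex_independent:
  fixes Q :: "nat \<Rightarrow> (nat \<Rightarrow> bool) \<Rightarrow> bool"
  assumes fin: "\<And>k. finite (F k)" and disj: "disjoint_family F"
    and dep: "\<And>k X Y. (\<And>i. i \<in> F k \<Longrightarrow> X i = Y i) \<Longrightarrow> Q k X \<longleftrightarrow> Q k Y"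
    and prob: "\<And>k. \<kappa> \<le> cantor.prob {X. Q k X}" and pos: "0 < \<kappa>"
  shows "AE X in cantor_measure. \<exists>k. Q k X"
proof -
  have ind: "cantor.indep_vars (\<lambda>k. PiM (F k) (\<lambda>_. coin)) (\<lambda>k X. restrict (\<lambda>i. X i) (F k)) UNIV"
    by (rule cantor.indep_vars_restrict[OF indep_coordinates]) (use disj in auto)
  have sets: "S \<in> sets (PiM (F k) (\<lambda>_. coin))" if "S \<subseteq> space (PiM (F k) (\<lambda>_. coin))" for S k
  proof -
    have "sets (PiM (F k) (\<lambda>_. coin)) = sets (PiM (F k) (\<lambda>_. count_space UNIV))"
      by (rule sets_PiM_cong) auto
    also have "\<dots> = Pow (PiE (F k) (\<lambda>_. UNIV))"
      using fin by (subst count_space_PiM_finite) auto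
    finally show ?thesis using that by (auto simp: space_PiM)
  qed
  have "cantor.indep_events (\<lambda>k. {X \<in> space cantor_measure. \<not> Q k (restrict (\<lambda>i. X i) (F k))}) UNIV"
    by (rule cantor.indep_eventsI_indep_vars[OF ind]) (auto intro: sets)
  moreover have "Q k (restrict (\<lambda>i. X i) (F k)) \<longleftrightarrow> Q k X" for k X
    by (rule dep) simp
  ultimately have ie: "cantor.indep_events (\<lambda>k. {X. \<not> Q k X}) UNIV" by simp
  then have meas: "{X. \<not> Q k X} \<in> cantor.events" for k unfolding cantor.indep_events_def by auto
  have "cantor.prob {X. \<not> Q k X} = 1 - cantor.prob {X. Q k X}" for k
  proof -
    have "{X. Q k X} = space cantor_measure - {X. \<not> Q k X}" by auto
    then show ?thesis using cantor.prob_compl[OF meas[of k]] by simp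
  qed
  then have le: "cantor.prob {X. \<not> Q k X} \<le> 1 - \<kappa>" for k using prob[of k] by simp
  have bound: "cantor.prob (\<Inter>k. {X. \<not> Q k X}) \<le> (1 - \<kappa>) ^ Suc K" for K
  proof -
    have "cantor.prob (\<Inter>k. {X. \<not> Q k X}) \<le> cantor.prob (\<Inter>k\<in>{..K}. {X. \<not> Q k X})"
      by (rule cantor.finite_measure_mono) (use meas in auto)
    also have "\<dots> = (\<Prod>k\<in>{..K}. cantor.prob {X. \<not> Q k X})"
      using ie unfolding cantor.indep_events_def by auto
    also have "\<dots> \<le> (\<Prod>k\<in>{..K}. 1 - \<kappa>)" by (rule prod_mono) (use le in auto)
    finally show ?thesis by simp
  qed
  have "0 \<le> 1 - \<kappa>" using le[of 0] measure_nonneg[of cantor_measure "{X. \<not> Q 0 X}"] by linarith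
  then have "(\<lambda>K. (1 - \<kappa>) ^ Suc K) \<longlonglongrightarrow> 0"
    using pos by (intro LIMSEQ_Suc LIMSEQ_power_zero) auto
  then have "cantor.prob (\<Inter>k. {X. \<not> Q k X}) \<le> 0" using bound by (intro LIMSEQ_le_const) auto
  then have "(\<Inter>k. {X. \<not> Q k X}) \<in> null_sets cantor_measure"
    using meas by (intro null_setsI) (auto simp: cantor.emeasure_eq_measure measure_le_0_iff)
  then have "AE X in cantor_measure. X \<notin> (\<Inter>k. {X. \<not> Q k X})" by (rule AE_not_in)
  then show ?thesis by simp
qed

definition block :: "nat \<Rightarrow> nat \<Rightarrow> nat set" where
  "block c n = pr n ` {..<pfst n + c}"

lemma portion_block: "portion c n X \<longleftrightarrow> (\<forall>j\<in>block c n. X j)"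
  unfolding portion_def block_def by auto

lemma finite_block [simp]: "finite (block c n)" unfolding block_def by simp

lemma card_block: "card (block c n) = pfst n + c"
  unfolding block_def by (subst card_image) (auto simp: inj_on_def)

lemma block_disjoint: "m \<noteq> n \<Longrightarrow> block c m \<inter> block c n = {}"
  unfolding block_def by auto

lemma portion_measurable [measurable]: "Measurable.pred cantor_measure (portion c n)"
  unfolding portion_def[abs_def] by measurable

lemma portion_sets [simp]: "{X. portion c n X} \<in> cantor.events"
  using portion_measurable[of c n] unfolding pred_def by simp

lemma prob_portion: "cantor.prob {X. portion c n X} = (1/2) ^ (pfst n + c)"
  unfolding portion_block using prob_all_true[of "block c n"] by (simp add: card_block)

lemma prob_portion_both:
  assumes "m \<noteq> n"
  shows "cantor.prob {X. portion c m X \<and> portion c n X} = (1/2) ^ (pfst m + c) * (1/2) ^ (pfst n + c)"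
proof -
  have "{X. portion c m X \<and> portion c n X} = {X. \<forall>j\<in>block c m \<union> block c n. X j}"
    unfolding portion_block by auto
  moreover have "card (block c m \<union> block c n) = (pfst m + c) + (pfst n + c)"
    using block_disjoint[OF assms] by (simp add: card_Un_disjoint card_block)
  ultimately show ?thesis using prob_all_true[of "block c m \<union> block c n"] by (simp add: power_add)
qed

text \<open>
  Attempts of distinct strategies have distinct exponents, so a geometric series bounds the sum; for
  \<open>c \<ge> 2\<close> its value is at most one half.
\<close>

lemma sum_portions:
  assumes "finite J" "inj_on pfst J" "2 \<le> c"
  shows "(\<Sum>n\<in>J. (1/2) ^ (pfst n + c)) \<le> (1/2 :: real)"
proof -
  have "(\<Sum>n\<in>J. (1/2) ^ (pfst n + c)) = (\<Sum>q\<in>pfst ` J. (1/2 :: real) ^ (q + c))"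
    by (simp add: sum.reindex[OF assms(2)])
  also have "\<dots> \<le> (\<Sum>q. (1/2) ^ (q + c))"
    by (rule sum_le_suminf) (use assms(1) in \<open>auto intro!: summable_mult2 simp: power_add\<close>)
  also have "\<dots> = 2 * (1/2) ^ c" by (simp add: power_add suminf_mult2[symmetric] suminf_geometric)
  also have "\<dots> \<le> 2 * (1/2) ^ 2" using assms(3) by (intro mult_left_mono power_decreasing) auto
  finally show ?thesis by (simp add: power2_eq_square)
qed

context low2_re begin

lemma opened_unique:
  assumes "opened x m" "opened x n" "pfst m = pfst n" "m < n"
  obtains t where "m < t" "t < n" "ready x m t"
proof (rule ccontr)
  assume "\<not> thesis"
  then have "wait x (pfst n) n = Suc m" unfolding wait_Suc_iff using assms that by auto
  then show False using assms(2) unfolding opened_def by simp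
qed

text \<open>
  Attempts on which a sequence may still be waiting at stage \<open>n\<close>, except those that are never
  released, which are accounted for by \<^const>\<open>stuck\<close>. Leaving out the latter makes every attempt
  block only finitely many stages.
\<close>

definition blocking :: "nat \<Rightarrow> nat \<Rightarrow> nat set" where
  "blocking x n = {m. m < n \<and> opened x m \<and> (\<exists>t>m. ready x m t) \<and> (\<forall>t. m < t \<and> t < n \<longrightarrow> \<not> ready x m t)}"

lemma finite_blocking [simp]: "finite (blocking x n)"
  unfolding blocking_def by simp

lemma inj_on_blocking: "inj_on pfst (blocking x n)"
proof (rule linorder_inj_onI)
  fix m m' assume *: "m < m'" "m \<in> blocking x n" "m' \<in> blocking x n"
  show "pfst m \<noteq> pfst m'"
  proof
    assume "pfst m = pfst m'"
    then obtain t where "m < t" "t < m'" "ready x m t"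
      using opened_unique[of x m m'] * unfolding blocking_def by blast
    then show False using * unfolding blocking_def by auto
  qed
qed (rule linear)

lemma busy_free:
  assumes "\<not> stuck x c X" "\<And>m. m \<in> blocking x n \<Longrightarrow> \<not> portion c m X"
  shows "busy x c X n = 0"
proof (rule ccontr)
  assume "busy x c X n \<noteq> 0"
  then obtain m where "busy x c X n = Suc m" by (meson not0_implies_Suc)
  then have m: "m < n" "opened x m" "portion c m X" "\<forall>t. m < t \<and> t < n \<longrightarrow> \<not> ready x m t"
    unfolding busy_def pending_Suc_iff by auto
  then have "m \<in> blocking x n" using assms(1) unfolding stuck_def blocking_def by blast
  then show False using assms(2) m(3) by blast
qed

text \<open>
  The coin test of \<open>n\<close> is independent of each coin test of a blocking attempt, and the latter have
  total probability at most one half because they belong to distinct strategies.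
\<close>

lemma prob_portion_unblocked:
  assumes "2 \<le> c"
  shows "(1/2) ^ (pfst n + c) / 2 \<le> cantor.prob {X. portion c n X \<and> (\<forall>m\<in>blocking x n. \<not> portion c m X)}"
    (is "_ \<le> cantor.prob ?O")
proof -
  let ?p = "\<lambda>n. (1/2 :: real) ^ (pfst n + c)"
  let ?B = "\<lambda>m. {X. portion c m X \<and> portion c n X}"
  have O [measurable]: "?O \<in> cantor.events"
  proof -
    have "?O = {X. portion c n X} \<inter> (\<Inter>m\<in>blocking x n. space cantor_measure - {X. portion c m X}) \<inter> space cantor_measure"
      by auto
    also have "\<dots> \<in> cantor.events"
      by (cases "blocking x n = {}") (auto intro!: sets.Int sets.finite_INT sets.Diff)
    finally show ?thesis .
  qed
  have B: "?B m \<in> cantor.events" for m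
    using sets.Int[OF portion_sets portion_sets, of c m c n] by (simp add: Collect_conj_eq)
  have "?p n = cantor.prob {X. portion c n X}" by (simp add: prob_portion)
  also have "\<dots> \<le> cantor.prob (?O \<union> (\<Union>m\<in>blocking x n. ?B m))"
    by (rule cantor.finite_measure_mono) (use O B in auto)
  also have "\<dots> \<le> cantor.prob ?O + cantor.prob (\<Union>m\<in>blocking x n. ?B m)"
    by (rule measure_Un_le) (use O B in auto)
  also have "cantor.prob (\<Union>m\<in>blocking x n. ?B m) \<le> (\<Sum>m\<in>blocking x n. cantor.prob (?B m))"
    by (rule measure_UNION_le) (use B in auto)
  also have "\<dots> = (\<Sum>m\<in>blocking x n. ?p m * ?p n)"
    by (intro sum.cong refl prob_portion_both) (auto simp: blocking_def)
  also have "\<dots> = (\<Sum>m\<in>blocking x n. ?p m) * ?p n" by (simp add: sum_distrib_right)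
  also have "\<dots> \<le> (1/2) * ?p n"
    by (intro mult_right_mono sum_portions inj_on_blocking assms) auto
  finally show ?thesis by simp
qed

text \<open>
  The attempts of one strategy have coin tests of equal probability. Passing to a subsequence in which each
  attempt and its blockers come after the previous attempt, the events of taking part depend on
  disjoint sets of coins.
\<close>

lemma AE_stuck_or_served:
  assumes "2 \<le> c" and inf: "\<And>N. \<exists>n\<ge>N. pfst n = q \<and> success x e n"
  shows "AE X in cantor_measure. stuck x c X \<or> (\<exists>n. success x e n \<and> portion c n X \<and> busy x c X n = 0)"
proof -
  have later: "\<exists>n. (pfst n = q \<and> success x e n) \<and> blocking x n \<subseteq> {N..} \<and> N \<le> n" for N
  proof -
    define T where "T = release x"
    have T: "m < T m \<and> ready x m (T m)" if "\<exists>t>m. ready x m t" for m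
      unfolding T_def release_def using that by (rule LeastI_ex[of "\<lambda>t. m < t \<and> ready x m t"])
    \<comment> \<open>beyond all release stages of attempts up to \<open>N\<close>, none of these attempts can block\<close>
    obtain n where n: "n \<ge> Suc (Max (T ` {..N}) + N)" "pfst n = q" "success x e n" using inf by blast
    have "blocking x n \<subseteq> {N..}"
    proof
      fix m assume m: "m \<in> blocking x n"
      show "m \<in> {N..}"
      proof (rule ccontr)
        assume "m \<notin> {N..}"
        then have "T m \<le> Max (T ` {..N})" by (intro Max_ge) auto
        then have "T m < n" using n(1) by simp
        then show False using m T[of m] unfolding blocking_def by blast
      qed
    qed
    then show ?thesis using n by (intro exI[of _ n]) auto
  qed
  obtain f where f: "\<And>k. pfst (f k) = q \<and> success x e (f k)"
    "\<And>k. blocking x (f (Suc k)) \<subseteq> {Suc (f k)..} \<and> Suc (f k) \<le> f (Suc k)"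
    using dependent_nat_choice[of "\<lambda>_ n. pfst n = q \<and> success x e n"
        "\<lambda>_ n n'. blocking x n' \<subseteq> {Suc n..} \<and> Suc n \<le> n'"] later by metis
  define I where "I k = insert (f k) (blocking x (f k))" for k
  define F where "F k = (\<Union>n\<in>I k. block c n)" for k
  have I_le: "I k \<subseteq> {..f k}" for k unfolding I_def blocking_def by auto
  have mono: "f j \<le> f k" if "j \<le> k" for j k
    using that by (rule lift_Suc_mono_le[rotated]) (use f(2) Suc_leD in blast)
  have I_disj: "I j \<inter> I k = {}" if jk: "j < k" for j k
  proof -
    obtain k' where k: "k = Suc k'" "j \<le> k'" using jk by (cases k) auto
    have "I k \<subseteq> {Suc (f k')..}" unfolding k I_def using f(2)[of k'] by auto
    moreover have "I j \<subseteq> {..f k'}" using I_le[of j] mono[OF k(2)] by auto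
    ultimately show ?thesis by fastforce
  qed
  have "AE X in cantor_measure. \<exists>k. portion c (f k) X \<and> (\<forall>m\<in>blocking x (f k). \<not> portion c m X)"
  proof (rule AE_ex_independent[of F _ "(1/2) ^ (q + c) / 2"])
    show "finite (F k)" for k unfolding F_def I_def by simp
    have F_disj: "F j \<inter> F k = {}" if jk: "j < k" for j k
    proof (rule equals0I)
      fix i assume "i \<in> F j \<inter> F k"
      then obtain m n where mn: "m \<in> I j" "n \<in> I k" "i \<in> block c m \<inter> block c n"
        unfolding F_def by blast
      then have "m \<noteq> n" using I_disj[OF jk] by blast
      from block_disjoint[OF this] mn(3) show False by blast
    qed
    then show "disjoint_family F"
      unfolding disjoint_family_on_def
    proof (intro ballI impI)
      fix j k :: nat assume "j \<noteq> k"
      then show "F j \<inter> F k = {}"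
        using F_disj[of j k] F_disj[of k j] by (auto simp: neq_iff)
    qed
    show "portion c (f k) X \<and> (\<forall>m\<in>blocking x (f k). \<not> portion c m X) \<longleftrightarrow>
      portion c (f k) Y \<and> (\<forall>m\<in>blocking x (f k). \<not> portion c m Y)"
      if XY: "\<And>i. i \<in> F k \<Longrightarrow> X i = Y i" for k X Y
    proof -
      have "portion c m X \<longleftrightarrow> portion c m Y" if m: "m \<in> I k" for m
        unfolding portion_block by (intro ball_cong refl XY) (use m in \<open>auto simp: F_def\<close>)
      then show ?thesis unfolding I_def by simp
    qed
    show "(1/2) ^ (q + c) / 2 \<le> cantor.prob {X. portion c (f k) X \<and> (\<forall>m\<in>blocking x (f k). \<not> portion c m X)}" for k
      using prob_portion_unblocked[OF assms(1), of "f k" x] f(1)[of k] by simp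
  qed simp
  then show ?thesis
  proof (rule AE_mp, intro AE_I2 impI)
    fix X assume "\<exists>k. portion c (f k) X \<and> (\<forall>m\<in>blocking x (f k). \<not> portion c m X)"
    then show "stuck x c X \<or> (\<exists>n. success x e n \<and> portion c n X \<and> busy x c X n = 0)"
      using busy_free f(1) by blast
  qed
qed

text \<open>
  Each strategy has at most one attempt that is opened and never released, so the stuck sequences are
  covered by one coin test per strategy.
\<close>

lemma stuck_measure:
  "\<exists>S. S \<in> cantor.events \<and> {X. stuck x c X} \<subseteq> S \<and> emeasure cantor_measure S \<le> ennreal (2 * (1/2) ^ c)"
proof -
  define U where "U = {n. opened x n \<and> \<not> (\<exists>t>n. ready x n t)}"
  have inj: "m = n" if "m \<in> U" "n \<in> U" "pfst m = pfst n" for m n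
    using that opened_unique[of x m n] opened_unique[of x n m] unfolding U_def
    by (metis (mono_tags, lifting) linorder_neqE_nat mem_Collect_eq)
  define S where "S q = (\<Union>n\<in>{n\<in>U. pfst n = q}. {X. portion c n X})" for q
  have S: "S q \<in> cantor.events \<and> emeasure cantor_measure (S q) \<le> ennreal ((1/2) ^ (q + c))" for q
  proof (cases "\<exists>n\<in>U. pfst n = q")
    case True
    then obtain n where n: "n \<in> U" "pfst n = q" by blast
    then have "{n\<in>U. pfst n = q} = {n}" using inj by blast
    then have "S q = {X. portion c n X}" unfolding S_def by simp
    then show ?thesis using prob_portion[of c n] n(2) by (simp add: cantor.emeasure_eq_measure)
  next
    case False
    then have "S q = {}" unfolding S_def by auto
    then show ?thesis by simp
  qed
  have "{X. stuck x c X} = (\<Union>q. S q)" unfolding stuck_def S_def U_def by auto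
  moreover have "(\<Union>q. S q) \<in> cantor.events" using S by auto
  moreover have "emeasure cantor_measure (\<Union>q. S q) \<le> (\<Sum>q. emeasure cantor_measure (S q))"
    by (rule emeasure_subadditive_countably) (use S in auto)
  moreover have "(\<Sum>q. emeasure cantor_measure (S q)) \<le> (\<Sum>q. ennreal ((1/2) ^ (q + c)))"
    by (rule suminf_le) (use S in auto)
  moreover have "(\<Sum>q. ennreal ((1/2) ^ (q + c))) = ennreal (\<Sum>q. (1/2) ^ (q + c))"
    by (rule suminf_ennreal2) (auto intro!: summable_mult2 simp: power_add)
  moreover have "(\<Sum>q. (1/2 :: real) ^ (q + c)) = 2 * (1/2) ^ c"
    by (simp add: power_add suminf_mult2[symmetric] suminf_geometric)
  ultimately show ?thesis by (intro exI[of _ "\<Union>q. S q"]) auto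
qed

lemma AE_not_always_stuck: "AE X in cantor_measure. \<exists>c\<ge>2. \<not> stuck x c X"
proof -
  obtain S where S: "\<And>c. S c \<in> cantor.events" "\<And>c. {X. stuck x c X} \<subseteq> S c"
    "\<And>c. emeasure cantor_measure (S c) \<le> ennreal (2 * (1/2) ^ c)"
    using stuck_measure[of x] by metis
  let ?N = "\<Inter>c. S (c + 2)"
  have le: "cantor.prob ?N \<le> 2 * (1/2) ^ (c + 2)" for c
  proof -
    have "cantor.prob ?N \<le> cantor.prob (S (c + 2))"
      by (rule cantor.finite_measure_mono) (use S(1) in auto)
    also have "\<dots> \<le> 2 * (1/2) ^ (c + 2)" using S(3)[of "c + 2"] by (simp add: cantor.emeasure_eq_measure)
    finally show ?thesis .
  qed
  have "(\<lambda>c. 2 * (1/2 :: real) ^ (c + 2)) \<longlonglongrightarrow> 2 * 0"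
    by (intro tendsto_mult tendsto_const LIMSEQ_ignore_initial_segment LIMSEQ_power_zero) auto
  then have "cantor.prob ?N \<le> 2 * 0" by (rule LIMSEQ_le_const) (use le in blast)
  then have "?N \<in> null_sets cantor_measure"
    using S(1) by (intro null_setsI) (auto simp: cantor.emeasure_eq_measure measure_le_0_iff)
  then have "AE X in cantor_measure. X \<notin> ?N" by (rule AE_not_in)
  then show ?thesis
  proof (rule AE_mp, intro AE_I2 impI)
    fix X assume "X \<notin> ?N"
    then obtain c where "X \<notin> S (c + 2)" by blast
    then show "\<exists>c\<ge>2. \<not> stuck x c X" using S(2) by (intro exI[of _ "c + 2"]) auto
  qed
qed

theorem AEWG_low2_re: "AEWG A"
proof -
  obtain x where x: "self_referential x" using self_referential_exists by blast
  let ?good = "\<lambda>e. \<exists>q. \<forall>N. \<exists>n\<ge>N. pfst n = q \<and> success x e n"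
  let ?srv = "\<lambda>c e X. \<exists>n. success x e n \<and> portion c n X \<and> busy x c X n = 0"
  have "AE X in cantor_measure. \<forall>c e. 2 \<le> c \<longrightarrow> ?good e \<longrightarrow> stuck x c X \<or> ?srv c e X"
    unfolding AE_all_countable
  proof (intro allI)
    fix c e
    show "AE X in cantor_measure. 2 \<le> c \<longrightarrow> ?good e \<longrightarrow> stuck x c X \<or> ?srv c e X"
    proof (cases "2 \<le> c \<and> ?good e")
      case True
      then obtain q where c: "2 \<le> c" and q: "\<And>N. \<exists>n\<ge>N. pfst n = q \<and> success x e n" by blast
      from AE_stuck_or_served[OF c q] show ?thesis by (rule eventually_mono) (rule impI)+
    next
      case False
      then show ?thesis by (intro AE_I2) blast
    qed
  qed
  with AE_not_always_stuck[of x] show ?thesis unfolding AEWG_def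
  proof eventually_elim
    case (elim X)
    then obtain c where c: "2 \<le> c" "\<not> stuck x c X" by blast
    have "weakly_1_generic A (generic_of x c X)"
    proof (rule generic_of_weakly_generic[OF _ x])
      fix e assume "?good e"
      then have "stuck x c X \<or> ?srv c e X" using elim(2) c(1) by (elim allE impE)
      then show "?srv c e X" using c(2) by (rule disjE[OF _ notE])
    qed
    with generic_of_turing_le[OF c(2)] show ?case by blast
  qed
qed

end

theorem theorem6:
  fixes A :: "nat set"
  assumes "recursively_enumerable A"
    and "low2 A"
  shows "AEWG A"
proof -
  obtain p where p: "A = {n. run {} p n \<noteq> None}" using assms(1) unfolding re_in_def by blast
  obtain a where a: "program_of a = p" using surj_program_of by (metis surjD)
  obtain r where r: "computable_in {} r"
    "\<And>z. \<forall>\<^sub>F s in sequentially. \<forall>\<^sub>F t in sequentially. r (pr (pr z s) t) = of_bool (z \<in> jump (jump A))"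
    using low2_approx[OF assms(2)] by blast
  interpret low2_re A a r
    using p a r by unfold_locales (simp_all add: enumerates_def)
  show ?thesis by (rule AEWG_low2_re)
qed

end
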